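(* Let $G$ be a profinite group with $w(G)=\aleph_1$. Then $\mathcal{S}(G)$ is homeomorphic to $\{0,1\}^{\aleph_1}$.
   Context: $w(G)$ is the weight of $G$: the least cardinality of a base for the topology of $G$. For a profinite group $G$, $\mathcal{S}(G)$ is the set of closed subgroups of $G$ with the profinite topology obtained from $\mathcal{S}(G)=\varprojlim\mathcal{S}(G_\lambda)$, where $G=\varprojlim G_\lambda$ with $G_\lambda$ finite and each finite set $\mathcal{S}(G_\lambda)$ is discrete; equivalently, the sets $B(H,N)=\{K \text{ a closed subgroup of } G\mid KN=HN\}$, with $N$ ranging over the open normal subgroups of $G$, form a base of open neighbourhoods of $H\in\mathcal{S}(G)$. $\{0,1\}^{\aleph_1}$ is the product of $\aleph_1$ copies of the two-point discrete space, with the product topology. *)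

theory Defs
  imports "HOL-Analysis.Analysis" "HOL-Algebra.Algebra"
begin

unbundle cardinal_syntax
no_notation elt_set_eq (infix \<open>=o\<close> 50) (* clashes with the equality of cardinals *)

definition topology_base :: "'a topology \<Rightarrow> 'a set set \<Rightarrow> bool" where
  "topology_base T \<B> \<longleftrightarrow> openin T = arbitrary union_of (\<lambda>U. U \<in> \<B>)"

text \<open>Cardinals are represented by cardinal orders, up to \<^term>\<open>(=o)\<close>; the weight is a cardinal
  order on some base of least cardinality, so it is only meaningful up to \<^term>\<open>(=o)\<close>.\<close>

definition weight :: "'a topology \<Rightarrow> 'a set rel" where
  "weight T = (SOME r. \<exists>\<B>. topology_base T \<B> \<and> r = |\<B>| \<and>
                 (\<forall>\<C>. topology_base T \<C> \<longrightarrow> |\<B>| \<le>o |\<C>| ))"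

lemma topology_base_openin: "topology_base T {U. openin T U}"
  unfolding topology_base_def openin_topology_base_unique by auto

lemma weight_is_least:
  obtains \<B> where "topology_base T \<B>" "weight T = |\<B>|"
    and "\<And>\<C>. topology_base T \<C> \<Longrightarrow> weight T \<le>o |\<C>|"
proof -
  let ?R = "card_of ` {\<B>. topology_base T \<B>}"
  have "?R \<noteq> {}"
    using topology_base_openin by blast
  then obtain r where "r \<in> ?R" "\<forall>r' \<in> ?R. r \<le>o r'"
    using exists_minim_Card_order[of ?R] card_of_Card_order by blast
  then have "\<exists>r \<B>. topology_base T \<B> \<and> r = |\<B>| \<and> (\<forall>\<C>. topology_base T \<C> \<longrightarrow> |\<B>| \<le>o |\<C>| )"
    by blast
  from someI_ex[OF this] obtain \<B> where "topology_base T \<B>" "weight T = |\<B>|"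
      "\<forall>\<C>. topology_base T \<C> \<longrightarrow> |\<B>| \<le>o |\<C>|"
    unfolding weight_def[symmetric] by (elim exE conjE) rule
  with that show thesis
    by simp
qed

definition aleph1 :: "nat set rel" where
  "aleph1 = cardSuc natLeq"

text \<open>The index set \<^term>\<open>Field aleph1\<close> is a canonical set of cardinality \<^term>\<open>aleph1\<close>.\<close>

definition cantor_cube_aleph1 :: "(nat set \<Rightarrow> bool) topology" where
  "cantor_cube_aleph1 = product_topology (\<lambda>_. discrete_topology (UNIV :: bool set)) (Field aleph1)"

lemma card_Field_aleph1: "|Field aleph1| =o aleph1"
  unfolding aleph1_def by (simp add: card_of_Field_ordIso cardSuc_Card_order natLeq_Card_order)

locale topological_group = group G for G (structure) +
  fixes T :: "'a topology"
  assumes topspace_eq: "topspace T = carrier G"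
    and continuous_mult: "continuous_map (prod_topology T T) T (\<lambda>(x, y). x \<otimes> y)"
    and continuous_inv: "continuous_map T T (\<lambda>x. inv x)"

definition totally_disconnected_space :: "'a topology \<Rightarrow> bool" where
  "totally_disconnected_space T \<longleftrightarrow> (\<forall>x \<in> topspace T. connected_component_of_set T x = {x})"

locale profinite_group = topological_group +
  assumes compact: "compact_space T"
    and Hausdorff: "Hausdorff_space T"
    and totally_disconnected: "totally_disconnected_space T"

definition closed_subgroups :: "('a, 'b) monoid_scheme \<Rightarrow> 'a topology \<Rightarrow> 'a set set" where
  "closed_subgroups G T = {H. subgroup H G \<and> closedin T H}"

definition open_normal_subgroups :: "('a, 'b) monoid_scheme \<Rightarrow> 'a topology \<Rightarrow> 'a set set" where
  "open_normal_subgroups G T = {N. N \<lhd> G \<and> openin T N}"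

definition subgroup_nbhd ::
    "('a, 'b) monoid_scheme \<Rightarrow> 'a topology \<Rightarrow> 'a set \<Rightarrow> 'a set \<Rightarrow> 'a set set" where
  "subgroup_nbhd G T H N = {K \<in> closed_subgroups G T. K <#>\<^bsub>G\<^esub> N = H <#>\<^bsub>G\<^esub> N}"

definition subgroup_space :: "('a, 'b) monoid_scheme \<Rightarrow> 'a topology \<Rightarrow> 'a set topology" where
  "subgroup_space G T = topology_generated_by
     {subgroup_nbhd G T H N | H N. H \<in> closed_subgroups G T \<and> N \<in> open_normal_subgroups G T}"

text \<open>The generating family is a base and not merely a subbase, and the sets
  \<^term>\<open>subgroup_nbhd G T H N\<close> form a base of open neighbourhoods of \<^term>\<open>H\<close>.\<close>

context topological_group
begin

lemma carrier_open_normal: "carrier G \<in> open_normal_subgroups G T"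
  unfolding open_normal_subgroups_def
  using normal_self openin_topspace[of T] topspace_eq by auto

lemma open_normal_Int:
  assumes "M \<in> open_normal_subgroups G T" "N \<in> open_normal_subgroups G T"
  shows "M \<inter> N \<in> open_normal_subgroups G T"
  using assms normal_subgroup_intersect unfolding open_normal_subgroups_def by auto

lemma subgroup_nbhd_mono:
  assumes M: "M \<in> open_normal_subgroups G T" and N: "N \<in> open_normal_subgroups G T"
    and "M \<subseteq> N" and H: "H \<in> closed_subgroups G T"
  shows "subgroup_nbhd G T H M \<subseteq> subgroup_nbhd G T H N"
proof -
  have sM: "subgroup M G" and sN: "subgroup N G"
    using M N by (auto simp: open_normal_subgroups_def normal_imp_subgroup)
  have MN: "M <#> N = N"
  proof
    show "M <#> N \<subseteq> N"
      using \<open>M \<subseteq> N\<close> subgroup.m_closed[OF sN] by (auto simp: set_mult_def)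
    show "N \<subseteq> M <#> N"
      using subgroup.one_closed[OF sM] subgroup.mem_carrier[OF sN] by (force simp: set_mult_def)
  qed
  have *: "K <#> N = (K <#> M) <#> N" if "K \<in> closed_subgroups G T" for K
  proof -
    have "K \<subseteq> carrier G"
      using that subgroup.subset by (auto simp: closed_subgroups_def)
    from set_mult_assoc[OF this subgroup.subset[OF sM] subgroup.subset[OF sN]] show ?thesis
      by (simp only: MN)
  qed
  show ?thesis
  proof
    fix K
    assume "K \<in> subgroup_nbhd G T H M"
    then have K: "K \<in> closed_subgroups G T" and KM: "K <#> M = H <#> M"
      by (simp_all add: subgroup_nbhd_def)
    have "K <#> N = H <#> N"
      by (subst *[OF K], subst *[OF H], simp only: KM)
    with K show "K \<in> subgroup_nbhd G T H N"
      by (simp add: subgroup_nbhd_def)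
  qed
qed

lemma openin_subgroup_nbhd:
  assumes "H \<in> closed_subgroups G T" "N \<in> open_normal_subgroups G T"
  shows "openin (subgroup_space G T) (subgroup_nbhd G T H N)"
  unfolding subgroup_space_def using assms by (intro topology_generated_by_Basis) blast

lemma openin_subgroup_space:
  "openin (subgroup_space G T) U \<longleftrightarrow>
     U \<subseteq> closed_subgroups G T \<and>
     (\<forall>H \<in> U. \<exists>N \<in> open_normal_subgroups G T. subgroup_nbhd G T H N \<subseteq> U)"
    (is "_ \<longleftrightarrow> ?P U")
proof
  assume "openin (subgroup_space G T) U"
  then have "generate_topology_on
      {subgroup_nbhd G T H N | H N. H \<in> closed_subgroups G T \<and> N \<in> open_normal_subgroups G T} U"
    unfolding subgroup_space_def by (rule openin_topology_generated_by)
  then show "?P U"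
  proof induction
    case Empty
    show ?case by simp
  next
    case (Int U V)
    have "\<exists>N \<in> open_normal_subgroups G T. subgroup_nbhd G T H N \<subseteq> U \<inter> V" if H: "H \<in> U \<inter> V" for H
    proof -
      obtain M N where MN: "M \<in> open_normal_subgroups G T" "N \<in> open_normal_subgroups G T"
        "subgroup_nbhd G T H M \<subseteq> U" "subgroup_nbhd G T H N \<subseteq> V"
        using Int H by blast
      have "H \<in> closed_subgroups G T"
        using Int H by blast
      then have "subgroup_nbhd G T H (M \<inter> N) \<subseteq> U \<inter> V"
        using MN subgroup_nbhd_mono[OF open_normal_Int] by blast
      then show ?thesis
        using open_normal_Int MN by blast
    qed
    then show ?case
      using Int by blast
  next
    case (UN K)
    have "\<exists>N \<in> open_normal_subgroups G T. subgroup_nbhd G T H N \<subseteq> \<Union>K" if H: "H \<in> \<Union>K" for H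
    proof -
      obtain S where S: "S \<in> K" "H \<in> S"
        using H by blast
      with UN obtain N where "N \<in> open_normal_subgroups G T" "subgroup_nbhd G T H N \<subseteq> S"
        by meson
      with S show ?thesis
        by blast
    qed
    then show ?case
      using UN by (simp add: Sup_le_iff)
  next
    case (Basis S)
    then show ?case
      unfolding subgroup_nbhd_def by blast
  qed
next
  assume U: "?P U"
  have "\<exists>V. openin (subgroup_space G T) V \<and> H \<in> V \<and> V \<subseteq> U" if HU: "H \<in> U" for H
  proof -
    have H: "H \<in> closed_subgroups G T"
      using U HU by blast
    obtain N where N: "N \<in> open_normal_subgroups G T" "subgroup_nbhd G T H N \<subseteq> U"
      using U HU by blast
    have "H \<in> subgroup_nbhd G T H N"
      using H by (simp add: subgroup_nbhd_def)
    then show ?thesis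
      using N(2) openin_subgroup_nbhd[OF H N(1)] by (intro exI[of _ "subgroup_nbhd G T H N"] conjI)
  qed
  then show "openin (subgroup_space G T) U"
    by (subst openin_subopen) blast
qed

lemma topspace_subgroup_space: "topspace (subgroup_space G T) = closed_subgroups G T"
proof
  show "topspace (subgroup_space G T) \<subseteq> closed_subgroups G T"
    using openin_subgroup_space openin_topspace by blast
  have "openin (subgroup_space G T) (closed_subgroups G T)"
    using carrier_open_normal by (auto simp: openin_subgroup_space subgroup_nbhd_def)
  then show "closed_subgroups G T \<subseteq> topspace (subgroup_space G T)"
    by (rule openin_subset)
qed

end

end

theory Submission
  imports Defs "HOL-Library.Countable_Set_Type"
begin

text \<open>Write \<open>X\<close> for the space of closed subgroups, and for a closed normal subgroup \<open>N\<close> let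
  \<open>E\<^sub>N\<close> be the equivalence relation \<open>HN = KN\<close> on \<open>X\<close>.  Its quotient is the space of closed
  subgroups of \<open>G/N\<close>.  The group is the limit of a continuous chain, of length \<open>\<omega>\<^sub>1\<close>, of metrizable
  quotients \<open>G/N\<close>, and so \<open>X\<close> is the limit of the corresponding spaces.  The idea is to show that
  each map in this chain is, after thinning out the chain, a projection with fibre a Cantor set.

  Such a projection is recognized by two properties.  The quotient map of \<open>X\<close> by \<open>E\<^sub>N\<close> is open
  (\<open>eq_mod_open\<close>), by a fibre product argument for subgroups.  And if \<open>G/N\<close> is metrizable but \<open>G\<close> is
  not, then no point is isolated in its fibre (\<open>perfect_equiv_eq_mod\<close>).  The essential case is that
  of a closed subgroup \<open>H\<close> containing \<open>N\<close>, where a proper closed subgroup \<open>K\<close> with \<open>KN = H\<close> is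
  needed.  One takes for \<open>K\<close> the closed subgroup generated by a closed transversal of \<open>N\<close> in
  \<open>H\<close>.  The transversal is metrizable, since it is homeomorphic to \<open>H/N\<close>, and this forces \<open>K\<close> to be
  metrizable: a continuous homomorphism from \<open>K\<close> to a finite group is determined by its
  restriction to the transversal, which is constant on the parts of a clopen partition, and there
  are only countably many of these.  So \<open>K = H\<close> would make \<open>H\<close> metrizable, hence also \<open>N\<close> and \<open>G\<close>.

  The two properties allow to split the fibres.  Given an open equivalence relation on a Boolean
  space whose classes have no isolated points, every clopen set \<open>b\<close> can be captured by a single
  clopen set \<open>c\<close> which splits every class: \<open>b\<close> is determined by the class and by membership in \<open>c\<close>
  (\<open>exists_splitting_determining\<close>).  Refining the relation by \<open>c\<close> preserves both properties.
  Iterating countably often, and closing off, leads from \<open>N\<close> to a smaller \<open>N'\<close>, again with metrizable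
  quotient, together with countably many clopen sets which are independent on each class of \<open>E\<^sub>N\<close>
  and cut it down to the classes of \<open>E\<close> for \<open>N'\<close> (\<open>cube_stage_extend\<close>).  A transfinite recursion of
  length \<open>\<omega>\<^sub>1\<close> through a base of \<open>\<aleph>\<^sub>1\<close> open normal subgroups, taking unions at limits, produces an
  independent family of \<open>\<aleph>\<^sub>1\<close> clopen sets that separates the points of \<open>X\<close>.  Membership in these
  sets is the homeomorphism onto the cube.\<close>

section \<open>Open normal subgroups of a profinite group\<close>

context topological_group
begin

lemma continuous_map_mult:
  assumes "continuous_map S T f" "continuous_map S T g"
  shows "continuous_map S T (\<lambda>x. f x \<otimes> g x)"
proof -
  have "continuous_map S (prod_topology T T) (\<lambda>x. (f x, g x))"
    using assms by (simp add: continuous_map_pairedI)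
  from continuous_map_compose[OF this continuous_mult] show ?thesis
    by (simp add: o_def)
qed

lemma continuous_map_inverse:
  assumes "continuous_map S T f"
  shows "continuous_map S T (\<lambda>x. inv (f x))"
  using continuous_map_compose[OF assms continuous_inv] by (simp add: o_def)

lemma continuous_map_constant: "c \<in> carrier G \<Longrightarrow> continuous_map S T (\<lambda>_. c)"
  by (simp add: topspace_eq)

lemma open_normalD:
  assumes "V \<in> open_normal_subgroups G T"
  shows "V \<lhd> G" "subgroup V G" "openin T V" "V \<subseteq> carrier G" "\<one> \<in> V"
  using assms openin_subset[of T V] unfolding open_normal_subgroups_def
  by (auto simp: normal_imp_subgroup subgroup.one_closed topspace_eq)

lemma open_normal_conj:
  assumes "V \<in> open_normal_subgroups G T" "x \<in> V" "g \<in> carrier G"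
  shows "g \<otimes> x \<otimes> inv g \<in> V" "inv g \<otimes> x \<otimes> g \<in> V"
  using normal.inv_op_closed1[OF open_normalD(1)] normal.inv_op_closed2[OF open_normalD(1)] assms
  by blast+

lemma mult_inv_cancel:
  assumes "a \<in> carrier G" "b \<in> carrier G"
  shows "a \<otimes> (inv a \<otimes> b) = b" "inv a \<otimes> (a \<otimes> b) = b"
  using assms by (simp_all flip: m_assoc)

lemma set_mult_memI: "a \<in> A \<Longrightarrow> b \<in> B \<Longrightarrow> a \<otimes> b \<in> A <#> B"
  by (auto simp: set_mult_def)

lemma mem_set_mult_iff:
  assumes "A \<subseteq> carrier G" "subgroup V G"
  shows "y \<in> A <#> V \<longleftrightarrow> y \<in> carrier G \<and> (\<exists>a\<in>A. inv a \<otimes> y \<in> V)"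
proof
  assume "y \<in> A <#> V"
  then obtain a v where av: "a \<in> A" "v \<in> V" "y = a \<otimes> v"
    by (auto simp: set_mult_def)
  moreover have "a \<in> carrier G" "v \<in> carrier G"
    using av assms(1) subgroup.mem_carrier[OF assms(2)] by auto
  ultimately show "y \<in> carrier G \<and> (\<exists>a\<in>A. inv a \<otimes> y \<in> V)"
    by (auto simp flip: m_assoc intro!: bexI[of _ a])
next
  assume "y \<in> carrier G \<and> (\<exists>a\<in>A. inv a \<otimes> y \<in> V)"
  then obtain a where a: "a \<in> A" "inv a \<otimes> y \<in> V" and y: "y \<in> carrier G"
    by blast
  have "a \<otimes> (inv a \<otimes> y) = y"
    using a y assms by (simp flip: m_assoc add: subsetD)
  with a show "y \<in> A <#> V"
    unfolding set_mult_def by force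
qed

lemma subset_set_mult:
  assumes "A \<subseteq> carrier G" "subgroup V G"
  shows "A \<subseteq> A <#> V"
proof
  fix a assume a: "a \<in> A"
  with set_mult_memI[OF a subgroup.one_closed[OF assms(2)]] show "a \<in> A <#> V"
    using assms(1) by (auto simp: subsetD)
qed

lemma set_mult_mono_left: "A \<subseteq> B \<Longrightarrow> A <#> N \<subseteq> B <#> N"
  by (auto simp: set_mult_def)

lemma set_mult_absorb:
  assumes "subgroup N G" "subgroup M G" "N \<subseteq> M"
  shows "N <#> M = M" "M <#> N = M"
proof -
  have "N \<subseteq> carrier G" "M \<subseteq> carrier G"
    using assms subgroup.subset by auto
  moreover have "m \<otimes> n \<in> M" "n \<otimes> m \<in> M" if "n \<in> N" "m \<in> M" for n m
    using that assms(3) by (auto intro!: subgroup.m_closed[OF assms(2)])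
  ultimately have "N <#> M \<subseteq> M" "M <#> N \<subseteq> M"
    by (auto simp: set_mult_def)
  moreover have "m \<in> N <#> M" "m \<in> M <#> N" if m: "m \<in> M" for m
  proof -
    have "m \<in> carrier G"
      by (rule subgroup.mem_carrier[OF assms(2) m])
    then show "m \<in> N <#> M" "m \<in> M <#> N"
      using set_mult_memI[OF subgroup.one_closed[OF assms(1)] m]
        set_mult_memI[OF m subgroup.one_closed[OF assms(1)]] by simp_all
  qed
  ultimately show "N <#> M = M" "M <#> N = M"
    by blast+
qed

lemma set_mult_absorb_right:
  assumes "A \<subseteq> carrier G" "subgroup N G" "subgroup M G" "N \<subseteq> M"
  shows "A <#> N <#> M = A <#> M"
  using set_mult_assoc[OF assms(1) subgroup.subset[OF assms(2)] subgroup.subset[OF assms(3)]]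
  by (simp add: set_mult_absorb(1)[OF assms(2-4)])

text \<open>This is why the equivalence relations studied below become finer as \<^term>\<open>N\<close> shrinks.\<close>

lemma set_mult_eq_mono:
  assumes "A <#> N = B <#> N" "A \<subseteq> carrier G" "B \<subseteq> carrier G"
    and "subgroup N G" "subgroup M G" "N \<subseteq> M"
  shows "A <#> M = B <#> M"
  using set_mult_absorb_right[OF assms(2,4-6)] set_mult_absorb_right[OF assms(3-6)] assms(1)
  by simp

lemma openin_saturated:
  assumes V: "V \<in> open_normal_subgroups G T" and A: "A \<subseteq> carrier G"
    and sat: "\<And>a b. \<lbrakk>a \<in> A; b \<in> carrier G; inv a \<otimes> b \<in> V\<rbrakk> \<Longrightarrow> b \<in> A"
  shows "openin T A"
proof (subst openin_subopen, intro ballI)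
  fix a assume a: "a \<in> A"
  let ?U = "{b \<in> topspace T. inv a \<otimes> b \<in> V}"
  have "continuous_map T T (\<lambda>b. inv a \<otimes> b)"
    using a A by (intro continuous_map_mult continuous_map_constant) auto
  then have "openin T ?U"
    using open_normalD(3)[OF V] by (rule openin_continuous_map_preimage)
  moreover have "a \<in> ?U"
    using a A open_normalD(5)[OF V] by (auto simp: topspace_eq)
  moreover have "?U \<subseteq> A"
    using sat[OF a] by (auto simp: topspace_eq)
  ultimately show "\<exists>U. openin T U \<and> a \<in> U \<and> U \<subseteq> A"
    by blast
qed

lemma closedin_saturated:
  assumes V: "V \<in> open_normal_subgroups G T" and A: "A \<subseteq> carrier G"
    and sat: "\<And>a b. \<lbrakk>a \<in> A; b \<in> carrier G; inv a \<otimes> b \<in> V\<rbrakk> \<Longrightarrow> b \<in> A"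
  shows "closedin T A"
proof -
  have "openin T (carrier G - A)"
  proof (rule openin_saturated[OF V])
    fix a b assume ab: "a \<in> carrier G - A" "b \<in> carrier G" "inv a \<otimes> b \<in> V"
    have "inv b \<otimes> a = inv (inv a \<otimes> b)"
      using ab by (simp add: inv_mult_group)
    also have "\<dots> \<in> V"
      by (rule subgroup.m_inv_closed[OF open_normalD(2)[OF V] ab(3)])
    finally show "b \<in> carrier G - A"
      using sat[of b a] ab by auto
  qed auto
  then show ?thesis
    using A by (simp add: closedin_def topspace_eq)
qed

lemma clopen_set_mult:
  assumes V: "V \<in> open_normal_subgroups G T" and A: "A \<subseteq> carrier G"
  shows "openin T (A <#> V)" "closedin T (A <#> V)"
proof -
  note V' = open_normalD(2)[OF V]
  have sub: "A <#> V \<subseteq> carrier G"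
    using mem_set_mult_iff[OF A V'] by blast
  have *: "b \<in> A <#> V" if ab: "a \<in> A <#> V" "b \<in> carrier G" "inv a \<otimes> b \<in> V" for a b
  proof -
    obtain c where c: "c \<in> A" "inv c \<otimes> a \<in> V" and a: "a \<in> carrier G"
      using ab(1) unfolding mem_set_mult_iff[OF A V'] by blast
    have "inv c \<otimes> b = (inv c \<otimes> a) \<otimes> (inv a \<otimes> b)"
      using c a A ab(2) by (simp add: m_assoc mult_inv_cancel subsetD)
    also have "\<dots> \<in> V"
      by (rule subgroup.m_closed[OF V' c(2) ab(3)])
    finally show ?thesis
      unfolding mem_set_mult_iff[OF A V'] using c(1) ab(2) by blast
  qed
  show "openin T (A <#> V)" "closedin T (A <#> V)"
    using openin_saturated[OF V sub] closedin_saturated[OF V sub] * by blast+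
qed

lemma open_normal_closed: "V \<in> open_normal_subgroups G T \<Longrightarrow> closedin T V"
  using clopen_set_mult(2)[of V V] set_mult_absorb(1)[of V V] open_normalD by auto

lemma open_normal_finite_Inter:
  assumes "finite \<V>" "\<V> \<noteq> {}" "\<V> \<subseteq> open_normal_subgroups G T"
  shows "\<Inter>\<V> \<in> open_normal_subgroups G T"
  using assms by (induction rule: finite_ne_induct) (auto intro: open_normal_Int)

lemma closed_subgroupsD:
  assumes "H \<in> closed_subgroups G T"
  shows "subgroup H G" "closedin T H" "H \<subseteq> carrier G" "\<one> \<in> H"
  using assms subgroup.subset[of H G] by (auto simp: closed_subgroups_def subgroup.one_closed)

end

context profinite_group
begin

lemma closedin_set_mult:
  assumes "closedin T A" "closedin T B"
  shows "closedin T (A <#> B)"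
proof -
  have "compactin (prod_topology T T) (A \<times> B)"
    using assms closedin_compact_space[OF compact] by (simp add: compactin_Times)
  then have "compactin T ((\<lambda>(x, y). x \<otimes> y) ` (A \<times> B))"
    using continuous_mult by (rule image_compactin)
  moreover have "(\<lambda>(x, y). x \<otimes> y) ` (A \<times> B) = A <#> B"
    unfolding set_mult_def by force
  ultimately have "compactin T (A <#> B)"
    by simp
  then show ?thesis
    using Hausdorff compactin_imp_closedin by blast
qed

end

definition down_directed :: "'a set set \<Rightarrow> bool" where
  "down_directed \<N> \<longleftrightarrow> \<N> \<noteq> {} \<and> (\<forall>A\<in>\<N>. \<forall>B\<in>\<N>. \<exists>C\<in>\<N>. C \<subseteq> A \<inter> B)"

lemma down_directed_finite:
  assumes "down_directed \<N>" "finite \<F>" "\<F> \<subseteq> \<N>"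
  shows "\<exists>C\<in>\<N>. C \<subseteq> \<Inter>\<F>"
  using assms(2,3)
proof (induction rule: finite_induct)
  case empty
  then show ?case
    using assms(1) by (auto simp: down_directed_def)
next
  case (insert A \<F>)
  then obtain C where "C \<in> \<N>" "C \<subseteq> \<Inter>\<F>"
    by auto
  moreover obtain D where "D \<in> \<N>" "D \<subseteq> A \<inter> C"
    using assms(1) insert.prems \<open>C \<in> \<N>\<close> unfolding down_directed_def by (meson insert_subset)
  ultimately show ?case
    by blast
qed

lemma compact_directed_Inter_nonempty:
  assumes "compact_space S" "down_directed \<C>" "\<And>C. C \<in> \<C> \<Longrightarrow> closedin S C" "{} \<notin> \<C>"
  shows "\<Inter>\<C> \<noteq> {}"
proof -
  have "\<Inter>\<F> \<noteq> {}" if "finite \<F>" "\<F> \<subseteq> \<C>" for \<F>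
    using down_directed_finite[OF assms(2) that] assms(4) by (metis subset_empty)
  then show ?thesis
    using assms(1,3) unfolding compact_space_fip by (metis (no_types, lifting))
qed

lemma down_directed_decseq:
  fixes D :: "nat \<Rightarrow> 'a set"
  assumes "decseq D"
  shows "down_directed (range D)"
proof -
  have "D (max i j) \<subseteq> D i \<inter> D j" for i j
    using decseqD[OF assms, of i "max i j"] decseqD[OF assms, of j "max i j"] by simp
  then show ?thesis
    unfolding down_directed_def by blast
qed

lemma down_directed_image:
  assumes "down_directed \<N>" "\<And>A B. \<lbrakk>A \<in> \<N>; B \<in> \<N>; A \<subseteq> B\<rbrakk> \<Longrightarrow> f A \<subseteq> f B"
  shows "down_directed (f ` \<N>)"
proof -
  have "\<exists>C\<in>\<N>. f C \<subseteq> f A \<inter> f B" if AB: "A \<in> \<N>" "B \<in> \<N>" for A B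
  proof -
    obtain C where "C \<in> \<N>" "C \<subseteq> A \<inter> B"
      using assms(1) AB unfolding down_directed_def by blast
    then show ?thesis
      using assms(2)[of C A] assms(2)[of C B] AB by blast
  qed
  then show ?thesis
    using assms(1) unfolding down_directed_def by auto
qed

context topological_group
begin

lemma l_coset_eq_set_mult: "x <# V = {x} <#> V"
  by (auto simp: l_coset_def set_mult_def)

lemma mem_l_coset_iff:
  assumes "x \<in> carrier G" "subgroup V G"
  shows "y \<in> x <# V \<longleftrightarrow> y \<in> carrier G \<and> inv x \<otimes> y \<in> V"
  using assms by (simp add: l_coset_eq_set_mult mem_set_mult_iff)

lemma l_coset_eq_iff:
  assumes "x \<in> carrier G" "y \<in> carrier G" "subgroup V G"
  shows "x <# V = y <# V \<longleftrightarrow> inv x \<otimes> y \<in> V"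
proof
  assume "x <# V = y <# V"
  moreover have "y \<in> y <# V"
    using assms subgroup.one_closed[OF assms(3)] by (simp add: mem_l_coset_iff)
  ultimately have "y \<in> x <# V"
    by simp
  then show "inv x \<otimes> y \<in> V"
    using assms(1,3) by (simp add: mem_l_coset_iff)
next
  assume "inv x \<otimes> y \<in> V"
  then have "y \<in> x <# V"
    using assms by (simp add: mem_l_coset_iff)
  then show "x <# V = y <# V"
    using l_repr_independence assms by blast
qed

lemma normal_Inter:
  assumes "\<N> \<noteq> {}" "\<And>N. N \<in> \<N> \<Longrightarrow> N \<lhd> G"
  shows "\<Inter>\<N> \<lhd> G"
proof (rule normal_invI)
  show "subgroup (\<Inter>\<N>) G"
    using assms by (intro subgroups_Inter) (auto simp: normal_imp_subgroup)
  show "x \<otimes> h \<otimes> inv x \<in> \<Inter>\<N>" if "x \<in> carrier G" "h \<in> \<Inter>\<N>" for x h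
    using assms(2)[THEN normal.inv_op_closed2] that by blast
qed

lemma down_directed_open_normal: "down_directed (open_normal_subgroups G T)"
  unfolding down_directed_def using carrier_open_normal open_normal_Int by blast

end

context profinite_group
begin

text \<open>In a compact Hausdorff space the components are the quasi-components, so points are separated
  from closed sets by clopen sets as soon as all components are trivial.\<close>

lemma clopen_neighbourhood:
  assumes "openin T U" "x \<in> U"
  obtains C where "openin T C" "closedin T C" "x \<in> C" "C \<subseteq> U"
proof -
  have x: "x \<in> topspace T"
    using assms openin_subset by blast
  have "separated_between T {x} (topspace T - U)"
  proof (rule cut_wire_fence_theorem_gen[OF compact])
    show "compactin T {x}" "closedin T (topspace T - U)"
      using x assms by auto
    fix C assume C: "connectedin T C"
    show "disjnt C {x} \<or> disjnt C (topspace T - U)"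
    proof (cases "x \<in> C")
      case True
      then have "C \<subseteq> connected_component_of_set T x"
        by (intro connected_component_of_maximal[OF C])
      also have "\<dots> = {x}"
        using x totally_disconnected by (simp add: totally_disconnected_space_def)
      finally show ?thesis
        using assms(2) by (auto simp: disjnt_def)
    qed (simp add: disjnt_def)
  qed (use Hausdorff in simp)
  then obtain C where "openin T C" "closedin T C" "x \<in> C" "topspace T - U \<subseteq> topspace T - C"
    unfolding separated_between by auto
  moreover have "C \<subseteq> U"
    using calculation openin_subset[of T C] by auto
  ultimately show ?thesis
    by (rule_tac that)
qed

text \<open>The elements that may be inserted anywhere into a product without affecting membership in a
  clopen set \<open>C\<close> form a normal subgroup, as is plain from this description.  It lies in \<open>C\<close> if the
  identity does, and it is open because it is the complement of a projection along a compact factor.\<close>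

lemma open_normal_subgroup_inside:
  assumes "openin T U" "\<one> \<in> U"
  obtains V where "V \<in> open_normal_subgroups G T" "V \<subseteq> U"
proof -
  obtain C where C: "openin T C" "closedin T C" "\<one> \<in> C" "C \<subseteq> U"
    using clopen_neighbourhood[OF assms] .
  define V where "V = {g \<in> carrier G. \<forall>x\<in>carrier G. \<forall>y\<in>carrier G. x \<otimes> g \<otimes> y \<in> C \<longleftrightarrow> x \<otimes> y \<in> C}"
  have V: "g \<in> V \<Longrightarrow> g \<in> carrier G"
    "\<lbrakk>g \<in> V; x \<in> carrier G; y \<in> carrier G\<rbrakk> \<Longrightarrow> x \<otimes> g \<otimes> y \<in> C \<longleftrightarrow> x \<otimes> y \<in> C" for g x y
    by (auto simp: V_def)
  have "subgroup V G"
  proof (rule subgroupI)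
    show "V \<subseteq> carrier G" "V \<noteq> {}"
      by (auto simp: V_def intro!: exI[of _ \<one>])
  next
    fix g assume g: "g \<in> V"
    have "x \<otimes> inv g \<otimes> y \<in> C \<longleftrightarrow> x \<otimes> y \<in> C" if xy: "x \<in> carrier G" "y \<in> carrier G" for x y
      using V(2)[OF g, of "x \<otimes> inv g" y] V(1)[OF g] xy by (simp add: m_assoc mult_inv_cancel)
    then show "inv g \<in> V"
      using V(1)[OF g] by (auto simp: V_def)
  next
    fix g h assume g: "g \<in> V" and h: "h \<in> V"
    have "x \<otimes> (g \<otimes> h) \<otimes> y \<in> C \<longleftrightarrow> x \<otimes> y \<in> C" if xy: "x \<in> carrier G" "y \<in> carrier G" for x y
      using V(2)[OF g, of x "h \<otimes> y"] V(2)[OF h, of x y] V(1)[OF g] V(1)[OF h] xy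
      by (simp add: m_assoc)
    then show "g \<otimes> h \<in> V"
      using V(1)[OF g] V(1)[OF h] by (auto simp: V_def)
  qed
  moreover have "a \<otimes> g \<otimes> inv a \<in> V" if a: "a \<in> carrier G" and g: "g \<in> V" for a g
  proof -
    have "x \<otimes> (a \<otimes> g \<otimes> inv a) \<otimes> y \<in> C \<longleftrightarrow> x \<otimes> y \<in> C"
      if xy: "x \<in> carrier G" "y \<in> carrier G" for x y
      using V(2)[OF g, of "x \<otimes> a" "inv a \<otimes> y"] V(1)[OF g] a xy
      by (simp add: m_assoc mult_inv_cancel)
    then show ?thesis
      using V(1)[OF g] a by (auto simp: V_def)
  qed
  ultimately have "V \<lhd> G"
    by (intro normal_invI)
  moreover have "openin T V"
  proof -
    let ?Y = "prod_topology T T" and ?Z = "prod_topology T (prod_topology T T)"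
    have "continuous_map ?Z T (\<lambda>z. fst (snd z))" "continuous_map ?Z T (\<lambda>z. snd (snd z))"
      using continuous_map_compose[OF continuous_map_snd continuous_map_fst]
        continuous_map_compose[OF continuous_map_snd continuous_map_snd]
      unfolding o_def by blast+
    then have f: "continuous_map ?Z T (\<lambda>z. fst (snd z) \<otimes> fst z \<otimes> snd (snd z))"
      and g: "continuous_map ?Z T (\<lambda>z. fst (snd z) \<otimes> snd (snd z))"
      by (auto intro!: continuous_map_mult continuous_map_fst)
    let ?D = "{z \<in> topspace ?Z. fst (snd z) \<otimes> fst z \<otimes> snd (snd z) \<in> C} \<inter>
          {z \<in> topspace ?Z. fst (snd z) \<otimes> snd (snd z) \<in> topspace T - C} \<union>
        {z \<in> topspace ?Z. fst (snd z) \<otimes> fst z \<otimes> snd (snd z) \<in> topspace T - C} \<inter>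
          {z \<in> topspace ?Z. fst (snd z) \<otimes> snd (snd z) \<in> C}"
    have "closedin ?Z ?D"
      using C(1,2)
      by (intro closedin_Un closedin_Int closedin_continuous_map_preimage[OF f]
          closedin_continuous_map_preimage[OF g]) auto
    moreover have "compact_space ?Y"
      using compact by (simp add: compact_space_prod_topology)
    ultimately have "closedin T (fst ` ?D)"
      using closed_map_fst[of ?Y T] by (auto simp: closed_map_def)
    moreover have "?D = {(g, x, y). g \<in> carrier G \<and> x \<in> carrier G \<and> y \<in> carrier G \<and>
        (x \<otimes> g \<otimes> y \<in> C \<longleftrightarrow> x \<otimes> y \<notin> C)}" (is "_ = ?E")
      by (auto simp: topspace_eq)
    moreover have "fst ` ?E = {g \<in> carrier G. \<exists>x\<in>carrier G. \<exists>y\<in>carrier G.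
        x \<otimes> g \<otimes> y \<in> C \<longleftrightarrow> x \<otimes> y \<notin> C}"
      by force
    moreover have "V = topspace T - {g \<in> carrier G. \<exists>x\<in>carrier G. \<exists>y\<in>carrier G.
        x \<otimes> g \<otimes> y \<in> C \<longleftrightarrow> x \<otimes> y \<notin> C}"
      by (auto simp: V_def topspace_eq)
    ultimately show ?thesis
      by auto
  qed
  moreover have "V \<subseteq> U"
    
  proof
    fix g assume "g \<in> V"
    with V(2)[of g \<one> \<one>] V(1)[of g] C(3,4) show "g \<in> U"
      by auto
  qed
  ultimately show thesis
    using that by (auto simp: open_normal_subgroups_def)
qed

lemma Inter_open_normal: "\<Inter>(open_normal_subgroups G T) = {\<one>}"
proof -
  have "x = \<one>" if x: "x \<in> \<Inter>(open_normal_subgroups G T)" for x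
  proof (rule ccontr)
    assume "x \<noteq> \<one>"
    moreover have "x \<in> topspace T" "\<one> \<in> topspace T"
      using x carrier_open_normal by (auto simp: topspace_eq)
    ultimately obtain U where "openin T U" "\<one> \<in> U" "x \<notin> U"
      using Hausdorff unfolding Hausdorff_space_def disjnt_iff by metis
    then show False
      using open_normal_subgroup_inside[of U] x by blast
  qed
  then show ?thesis
    using open_normalD(5) by blast
qed

text \<open>If \<open>x\<close> lies in all the products, the elements of \<^term>\<open>C\<close> that witness this for the single members
  of \<^term>\<open>\<N>\<close> form a directed family of nonempty closed sets; a common element is a witness for
  the intersection.\<close>

lemma set_mult_Inter:
  assumes C: "closedin T C" and dir: "down_directed \<N>"
    and \<N>: "\<And>N. N \<in> \<N> \<Longrightarrow> subgroup N G \<and> closedin T N"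
  shows "C <#> \<Inter>\<N> = (\<Inter>N\<in>\<N>. C <#> N)"
proof
  have sub: "C \<subseteq> carrier G"
    using C closedin_subset topspace_eq by auto
  have ne: "\<N> \<noteq> {}"
    using dir by (simp add: down_directed_def)
  show "C <#> \<Inter>\<N> \<subseteq> (\<Inter>N\<in>\<N>. C <#> N)"
    by (auto simp: set_mult_def)
  show "(\<Inter>N\<in>\<N>. C <#> N) \<subseteq> C <#> \<Inter>\<N>"
  proof
    fix x assume x: "x \<in> (\<Inter>N\<in>\<N>. C <#> N)"
    then have xG: "x \<in> carrier G"
      using ne \<N> mem_set_mult_iff[OF sub] by (metis INT_iff all_not_in_conv)
    let ?f = "\<lambda>N. C \<inter> {c \<in> topspace T. inv c \<otimes> x \<in> N}"
    have cont: "continuous_map T T (\<lambda>c. inv c \<otimes> x)"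
      using xG by (intro continuous_map_mult continuous_map_inverse continuous_map_constant) auto
    have "\<Inter>(?f ` \<N>) \<noteq> {}"
    proof (rule compact_directed_Inter_nonempty[OF compact])
      show "down_directed (?f ` \<N>)"
        by (rule down_directed_image[OF dir]) auto
      show "closedin T D" if D: "D \<in> ?f ` \<N>" for D
      proof -
        obtain N where "N \<in> \<N>" "D = ?f N"
          using D by blast
        then show ?thesis
          using C \<N> cont by (auto intro!: closedin_Int closedin_continuous_map_preimage)
      qed
      show "{} \<notin> ?f ` \<N>"
      proof
        assume "{} \<in> ?f ` \<N>"
        then obtain N where N: "N \<in> \<N>" "{} = ?f N"
          unfolding image_iff by (elim bexE) rule
        have "x \<in> C <#> N"
          using x N(1) by blast
        then obtain c where "c \<in> C" "inv c \<otimes> x \<in> N"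
          using mem_set_mult_iff[OF sub, of N x] \<N>[OF N(1)] by blast
        then have "c \<in> ?f N"
          using sub by (auto simp: topspace_eq)
        with N(2) show False
          by blast
      qed
    qed
    then obtain c where "c \<in> C" "\<forall>N\<in>\<N>. inv c \<otimes> x \<in> N"
      using ne by blast
    moreover have "subgroup (\<Inter>\<N>) G"
      using ne \<N> by (intro subgroups_Inter) auto
    ultimately show "x \<in> C <#> \<Inter>\<N>"
      using xG by (auto simp: mem_set_mult_iff[OF sub])
  qed
qed

lemma closed_eq_Inter:
  assumes "closedin T C"
  shows "(\<Inter>V\<in>open_normal_subgroups G T. C <#> V) = C"
proof -
  have "C \<subseteq> carrier G"
    using assms closedin_subset topspace_eq by auto
  then have "C <#> {\<one>} = C"
    by (auto simp: set_mult_def subsetD)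
  moreover have "C <#> \<Inter>(open_normal_subgroups G T) = (\<Inter>V\<in>open_normal_subgroups G T. C <#> V)"
    by (rule set_mult_Inter[OF assms down_directed_open_normal])
      (auto simp: open_normal_closed open_normalD)
  ultimately show ?thesis
    by (simp add: Inter_open_normal)
qed

lemma finite_cosets:
  assumes V: "V \<in> open_normal_subgroups G T"
  shows "finite ((\<lambda>x. x <# V) ` carrier G)"
proof -
  note V' = open_normalD(2)[OF V]
  let ?R = "(\<lambda>x. x <# V) ` carrier G"
  have self: "x \<in> x <# V" if "x \<in> carrier G" for x
    using that V' subgroup.one_closed[OF V'] by (simp add: mem_l_coset_iff)
  have "openin T R" if "R \<in> ?R" for R
    using that clopen_set_mult(1)[OF V] by (auto simp: l_coset_eq_set_mult)
  moreover have "topspace T \<subseteq> \<Union>?R"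
    using self by (auto simp: topspace_eq)
  ultimately obtain \<F> where \<F>: "finite \<F>" "\<F> \<subseteq> ?R" "topspace T \<subseteq> \<Union>\<F>"
    using compact unfolding compact_space_alt by meson
  have "?R \<subseteq> \<F>"
  proof
    fix R assume "R \<in> ?R"
    then obtain x where x: "x \<in> carrier G" "R = x <# V"
      by blast
    then obtain F where F: "F \<in> \<F>" "x \<in> F"
      using \<F>(3) topspace_eq by blast
    then obtain y where y: "y \<in> carrier G" "F = y <# V"
      using \<F>(2) by blast
    have "inv y \<otimes> x \<in> V"
      using F(2) unfolding y(2) mem_l_coset_iff[OF y(1) V'] by blast
    then have "y <# V = x <# V"
      unfolding l_coset_eq_iff[OF y(1) x(1) V'] .
    with F x y show "R \<in> \<F>"
      by simp
  qed
  with \<F>(1) show ?thesis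
    by (rule finite_subset[rotated])
qed

lemma finite_coset_unions:
  assumes V: "V \<in> open_normal_subgroups G T"
  shows "finite {A. A \<subseteq> carrier G \<and> A <#> V = A}"
proof (rule finite_subset)
  show "{A. A \<subseteq> carrier G \<and> A <#> V = A} \<subseteq> Union ` Pow ((\<lambda>x. x <# V) ` carrier G)"
  proof clarify
    fix A assume A: "A \<subseteq> carrier G" "A <#> V = A"
    have "A = \<Union>((\<lambda>x. x <# V) ` A)"
      using A(2) by (auto simp: l_coset_def set_mult_def)
    with A(1) show "A \<in> Union ` Pow ((\<lambda>x. x <# V) ` carrier G)"
      by blast
  qed
qed (simp add: finite_cosets[OF V])

lemma closed_subgroup_mult:
  assumes H: "H \<in> closed_subgroups G T" and N: "N \<lhd> G" "closedin T N"
  shows "H <#> N \<in> closed_subgroups G T"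
proof -
  have "subgroup (N <#> H) G"
    using mult_norm_subgroup[OF N(1) closed_subgroupsD(1)[OF H]] .
  then have "subgroup (H <#> N) G"
    using commut_normal[OF closed_subgroupsD(1)[OF H] N(1)] by simp
  then show ?thesis
    using closedin_set_mult[OF closed_subgroupsD(2)[OF H] N(2)] by (simp add: closed_subgroups_def)
qed

lemma closed_subgroup_Int:
  assumes "H \<in> closed_subgroups G T" "K \<in> closed_subgroups G T"
  shows "H \<inter> K \<in> closed_subgroups G T"
  using assms subgroups_Inter_pair by (auto simp: closed_subgroups_def)

end

section \<open>The space of closed subgroups\<close>

context topological_group
begin

definition eq_mod :: "'a set \<Rightarrow> ('a set \<times> 'a set) set" where
  "eq_mod N = {(H, K). H \<in> closed_subgroups G T \<and> K \<in> closed_subgroups G T \<and> H <#> N = K <#> N}"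

lemma equiv_eq_mod: "equiv (closed_subgroups G T) (eq_mod N)"
  by (rule equivI) (auto simp: eq_mod_def refl_on_def sym_def trans_def)

lemma eq_mod_mono:
  assumes "subgroup N G" "subgroup M G" "N \<subseteq> M"
  shows "eq_mod N \<subseteq> eq_mod M"
proof clarify
  fix H K assume "(H, K) \<in> eq_mod N"
  then have HK: "H \<in> closed_subgroups G T" "K \<in> closed_subgroups G T" "H <#> N = K <#> N"
    by (auto simp: eq_mod_def)
  with set_mult_eq_mono[OF HK(3) closed_subgroupsD(3)[OF HK(1)] closed_subgroupsD(3)[OF HK(2)] assms]
  show "(H, K) \<in> eq_mod M"
    by (simp add: eq_mod_def)
qed

lemma saturated_clopen:
  assumes V: "V \<in> open_normal_subgroups G T" and B: "B \<subseteq> closed_subgroups G T" "eq_mod V `` B \<subseteq> B"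
  shows "openin (subgroup_space G T) B" "closedin (subgroup_space G T) B"
proof -
  have "subgroup_nbhd G T H V \<subseteq> B" if "H \<in> B" for H
    using that B by (auto simp: subgroup_nbhd_def eq_mod_def)
  then show "openin (subgroup_space G T) B"
    using V B(1) by (auto simp: openin_subgroup_space)
  have "subgroup_nbhd G T H V \<subseteq> closed_subgroups G T - B" if H: "H \<in> closed_subgroups G T - B" for H
  proof
    fix K assume K: "K \<in> subgroup_nbhd G T H V"
    then have "(K, H) \<in> eq_mod V"
      using H by (simp add: subgroup_nbhd_def eq_mod_def)
    then have "K \<in> B \<Longrightarrow> H \<in> B"
      using B(2) by blast
    with K H show "K \<in> closed_subgroups G T - B"
      by (auto simp: subgroup_nbhd_def)
  qed
  then have "openin (subgroup_space G T) (closed_subgroups G T - B)"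
    using V by (auto simp: openin_subgroup_space)
  then show "closedin (subgroup_space G T) B"
    using B(1) by (simp add: closedin_def topspace_subgroup_space)
qed

lemma subgroup_nbhd_clopen:
  assumes "V \<in> open_normal_subgroups G T" "H \<in> closed_subgroups G T"
  shows "openin (subgroup_space G T) (subgroup_nbhd G T H V)"
    "closedin (subgroup_space G T) (subgroup_nbhd G T H V)"
proof -
  have "subgroup_nbhd G T H V \<subseteq> closed_subgroups G T"
    "eq_mod V `` subgroup_nbhd G T H V \<subseteq> subgroup_nbhd G T H V"
    by (auto simp: subgroup_nbhd_def eq_mod_def)
  from saturated_clopen[OF assms(1) this]
  show "openin (subgroup_space G T) (subgroup_nbhd G T H V)"
    "closedin (subgroup_space G T) (subgroup_nbhd G T H V)" .
qed

end

context profinite_group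
begin

lemma eq_mod_Inter:
  assumes dir: "down_directed \<N>" and \<N>: "\<And>N. N \<in> \<N> \<Longrightarrow> subgroup N G \<and> closedin T N"
  shows "eq_mod (\<Inter>\<N>) = (\<Inter>N\<in>\<N>. eq_mod N)"
proof
  have ne: "\<N> \<noteq> {}"
    using dir by (simp add: down_directed_def)
  then have "subgroup (\<Inter>\<N>) G"
    using \<N> by (intro subgroups_Inter) auto
  then show "eq_mod (\<Inter>\<N>) \<subseteq> (\<Inter>N\<in>\<N>. eq_mod N)"
    using \<N> by (intro INT_greatest eq_mod_mono) auto
  show "(\<Inter>N\<in>\<N>. eq_mod N) \<subseteq> eq_mod (\<Inter>\<N>)"
  proof
    fix p assume p: "p \<in> (\<Inter>N\<in>\<N>. eq_mod N)"
    obtain H K where HK: "p = (H, K)"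
      by (cases p)
    have cs: "H \<in> closed_subgroups G T" "K \<in> closed_subgroups G T"
      using p ne by (auto simp: eq_mod_def HK)
    have "\<And>N. N \<in> \<N> \<Longrightarrow> H <#> N = K <#> N"
      using p by (auto simp: eq_mod_def HK)
    then have "H <#> \<Inter>\<N> = K <#> \<Inter>\<N>"
      using set_mult_Inter[OF closed_subgroupsD(2)[OF cs(1)] dir \<N>]
        set_mult_Inter[OF closed_subgroupsD(2)[OF cs(2)] dir \<N>] by simp
    with cs show "p \<in> eq_mod (\<Inter>\<N>)"
      by (simp add: eq_mod_def HK)
  qed
qed

lemma closed_subgroup_eqI:
  assumes "H \<in> closed_subgroups G T" "K \<in> closed_subgroups G T"
    and "\<And>V. V \<in> open_normal_subgroups G T \<Longrightarrow> H <#> V = K <#> V"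
  shows "H = K"
proof -
  have "(\<Inter>V\<in>open_normal_subgroups G T. H <#> V) = (\<Inter>V\<in>open_normal_subgroups G T. K <#> V)"
    by (rule INF_cong[OF refl assms(3)])
  then show ?thesis
    unfolding closed_eq_Inter[OF closed_subgroupsD(2)[OF assms(1)]]
      closed_eq_Inter[OF closed_subgroupsD(2)[OF assms(2)]] .
qed

text \<open>A closed subgroup \<^term>\<open>H\<close> amounts to the coherent family of the finitely-valued data
  \<^term>\<open>H <#> V\<close>, so the space is an image of a closed subspace of a product of finite discrete
  spaces.\<close>

lemma compact_subgroup_space: "compact_space (subgroup_space G T)"
proof -
  let ?O = "open_normal_subgroups G T"
  let ?F = "\<lambda>V. {A. A \<subseteq> carrier G \<and> A <#> V = A}"
  define Z where "Z = product_topology (\<lambda>V. discrete_topology (?F V)) ?O"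
  have topZ: "topspace Z = (\<Pi>\<^sub>E V\<in>?O. ?F V)"
    by (simp add: Z_def)
  have "compact_space Z"
    unfolding Z_def compact_space_product_topology
    by (simp add: compact_space_discrete_topology finite_coset_unions)
  define Z0 where "Z0 = {z \<in> topspace Z. (\<forall>V\<in>?O. subgroup (z V) G) \<and>
     (\<forall>V\<in>?O. \<forall>W\<in>?O. V \<subseteq> W \<longrightarrow> z V <#> W = z W)}"
  have cl: "closedin Z {z \<in> topspace Z. P (z V)}" and op: "openin Z {z \<in> topspace Z. P (z V)}"
    if "V \<in> ?O" for V P
  proof -
    have c: "continuous_map Z (discrete_topology (?F V)) (\<lambda>z. z V)"
      unfolding Z_def using that by (rule continuous_map_product_projection)
    have *: "{z \<in> topspace Z. P (z V)} = {z \<in> topspace Z. z V \<in> {A \<in> ?F V. P A}}"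
      using that unfolding topZ by auto
    show "closedin Z {z \<in> topspace Z. P (z V)}" "openin Z {z \<in> topspace Z. P (z V)}"
      unfolding * by (rule closedin_continuous_map_preimage[OF c] openin_continuous_map_preimage[OF c]; auto)+
  qed
  \<comment> \<open>Splitting the coherence condition according to the value of \<open>z V\<close> exhibits it as an intersection
    of unions of two clopen conditions.\<close>
  let ?C = "\<lambda>V W A. {z \<in> topspace Z. z V \<noteq> A} \<union> {z \<in> topspace Z. z W = A <#> W}"
  let ?\<C> = "{topspace Z} \<union> (\<lambda>V. {z \<in> topspace Z. subgroup (z V) G}) ` ?O \<union>
     (\<lambda>(V, W, A). ?C V W A) ` {(V, W, A). V \<in> ?O \<and> W \<in> ?O \<and> V \<subseteq> W}"
  have "closedin Z (\<Inter>?\<C>)"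
    by (rule closedin_Inter) (use cl in \<open>auto intro!: closedin_Un\<close>)
  moreover have "Z0 = \<Inter>?\<C>"
  proof
    show "Z0 \<subseteq> \<Inter>?\<C>"
      by (auto simp: Z0_def)
    show "\<Inter>?\<C> \<subseteq> Z0"
    proof
      fix z assume z: "z \<in> \<Inter>?\<C>"
      have "z V <#> W = z W" if "V \<in> ?O" "W \<in> ?O" "V \<subseteq> W" for V W
      proof -
        have "?C V W (z V) \<in> ?\<C>"
          by (rule UnI2, rule image_eqI[where x = "(V, W, z V)"]) (use that in auto)
        from InterD[OF z this] have "z \<in> ?C V W (z V)" .
        then show ?thesis
          by simp
      qed
      moreover have "subgroup (z V) G" if "V \<in> ?O" for V
      proof -
        have "{z \<in> topspace Z. subgroup (z V) G} \<in> ?\<C>"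
          using that by (intro UnI1 UnI2 imageI)
        from InterD[OF z this] show ?thesis
          by simp
      qed
      moreover have "z \<in> topspace Z"
        by (rule InterD[OF z]) simp
      ultimately show "z \<in> Z0"
        by (simp add: Z0_def)
    qed
  qed
  ultimately have "compactin Z Z0"
    using \<open>compact_space Z\<close> by (simp add: closedin_compact_space)
  define \<Psi> where "\<Psi> z = (\<Inter>V\<in>?O. z V)" for z :: "'a set \<Rightarrow> 'a set"
  have O_ne: "?O \<noteq> {}"
    using carrier_open_normal by blast
  have Z0: "z V \<subseteq> carrier G" "z V <#> V = z V" "subgroup (z V) G" "closedin T (z V)"
    if "z \<in> Z0" "V \<in> ?O" for z V
  proof -
    show *: "z V \<subseteq> carrier G" "z V <#> V = z V" "subgroup (z V) G"
      using that by (auto simp: Z0_def topZ PiE_iff)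
    show "closedin T (z V)"
      using clopen_set_mult(2)[OF that(2) *(1)] *(2) by simp
  qed
  have \<Psi>_cs: "\<Psi> z \<in> closed_subgroups G T" if "z \<in> Z0" for z
    using O_ne Z0[OF that] unfolding closed_subgroups_def \<Psi>_def
    by (auto intro!: subgroups_Inter closedin_Inter)
  have \<Psi>_mult: "\<Psi> z <#> W = z W" if z: "z \<in> Z0" and W: "W \<in> ?O" for z W
  proof -
    have mono: "z V \<subseteq> z V'" if "V \<in> ?O" "V' \<in> ?O" "V \<subseteq> V'" for V V'
    proof -
      have "z V <#> V' = z V'"
        using z that by (simp add: Z0_def)
      then show ?thesis
        using subset_set_mult[OF Z0(1)[OF z that(1)] open_normalD(2)[OF that(2)]] by simp
    qed
    have comm: "A <#> W = W <#> A" if "subgroup A G" for A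
      using commut_normal[OF that open_normalD(1)[OF W]] .
    have "\<Psi> z <#> W = W <#> \<Inter>(z ` ?O)"
      using comm[of "\<Psi> z"] closed_subgroupsD(1)[OF \<Psi>_cs[OF z]] by (simp add: \<Psi>_def)
    also have "\<dots> = (\<Inter>A\<in>z ` ?O. W <#> A)"
      using Z0(3,4)[OF z] down_directed_image[OF down_directed_open_normal mono]
      by (intro set_mult_Inter[OF open_normal_closed[OF W]]) auto
    also have "\<dots> = (\<Inter>V\<in>?O. z V <#> W)"
      using comm Z0(3)[OF z] by simp
    also have "\<dots> = z W"
    proof
      show "(\<Inter>V\<in>?O. z V <#> W) \<subseteq> z W"
        using W Z0(2)[OF z W] by blast
      have "z W \<subseteq> z V <#> W" if V: "V \<in> ?O" for V
      proof -
        have VW: "V \<inter> W \<in> ?O"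
          using open_normal_Int[OF V W] .
        have "z W = z (V \<inter> W) <#> W"
          using z W VW by (simp add: Z0_def)
        also have "\<dots> \<subseteq> z V <#> W"
          using mono[OF VW V] by (auto simp: set_mult_def)
        finally show ?thesis .
      qed
      then show "z W \<subseteq> (\<Inter>V\<in>?O. z V <#> W)"
        by blast
    qed
    finally show ?thesis .
  qed
  let ?Y = "subtopology Z Z0"
  have Z0_top: "Z0 \<subseteq> topspace Z"
    by (auto simp: Z0_def)
  have "continuous_map ?Y (subgroup_space G T) \<Psi>"
    unfolding subgroup_space_def
  proof (rule continuous_on_generated_topo)
    fix U assume "U \<in> {subgroup_nbhd G T H N |H N. H \<in> closed_subgroups G T \<and> N \<in> ?O}"
    then obtain H N where U: "U = subgroup_nbhd G T H N" and N: "N \<in> ?O"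
      by blast
    have *: "\<Psi> -` U \<inter> topspace ?Y = Z0 \<inter> {z \<in> topspace Z. z N = H <#> N}"
      using \<Psi>_cs \<Psi>_mult N Z0_top by (auto simp: U subgroup_nbhd_def)
    show "openin ?Y (\<Psi> -` U \<inter> topspace ?Y)"
      unfolding * by (rule openin_subtopology_Int2[OF op[OF N]])
  next
    have "\<Psi> z \<in> subgroup_nbhd G T (\<Psi> z) (carrier G)" if "z \<in> Z0" for z
      using \<Psi>_cs[OF that] by (simp add: subgroup_nbhd_def)
    then show "\<Psi> ` topspace ?Y \<subseteq>
        \<Union>{subgroup_nbhd G T H N |H N. H \<in> closed_subgroups G T \<and> N \<in> ?O}"
      using \<Psi>_cs carrier_open_normal by fastforce
  qed
  moreover have "\<Psi> ` topspace ?Y = closed_subgroups G T"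
  proof
    show "\<Psi> ` topspace ?Y \<subseteq> closed_subgroups G T"
      using \<Psi>_cs by auto
    show "closed_subgroups G T \<subseteq> \<Psi> ` topspace ?Y"
    proof
      fix H assume H: "H \<in> closed_subgroups G T"
      let ?z = "restrict (\<lambda>V. H <#> V) ?O"
      note HG = closed_subgroupsD(3)[OF H]
      have "H <#> V \<in> ?F V" if V: "V \<in> ?O" for V
        using set_mult_absorb_right[OF HG open_normalD(2)[OF V] open_normalD(2)[OF V]]
          closed_subgroupsD(3)[OF closed_subgroup_mult[OF H open_normalD(1)[OF V] open_normal_closed[OF V]]]
        by simp
      moreover have "subgroup (H <#> V) G" if V: "V \<in> ?O" for V
        using closed_subgroupsD(1)[OF closed_subgroup_mult[OF H open_normalD(1)[OF V] open_normal_closed[OF V]]] .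
      moreover have "H <#> V <#> W = H <#> W" if V: "V \<in> ?O" and W: "W \<in> ?O" and "V \<subseteq> W" for V W
        using set_mult_absorb_right[OF HG open_normalD(2)[OF V] open_normalD(2)[OF W] \<open>V \<subseteq> W\<close>] .
      ultimately have "?z \<in> Z0"
        by (auto simp: Z0_def topZ)
      moreover have "\<Psi> ?z = H"
        using closed_eq_Inter[OF closed_subgroupsD(2)[OF H]] by (simp add: \<Psi>_def)
      ultimately show "H \<in> \<Psi> ` topspace ?Y"
        using Z0_top by force
    qed
  qed
  moreover have "compactin ?Y (topspace ?Y)"
    using \<open>compactin Z Z0\<close> Z0_top by (simp add: compactin_subtopology inf_absorb2)
  ultimately show ?thesis
    using image_compactin[of ?Y "topspace ?Y" "subgroup_space G T" \<Psi>]
    by (simp add: compact_space_def topspace_subgroup_space)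
qed

lemma clopen_imp_saturated:
  assumes "openin (subgroup_space G T) B" "closedin (subgroup_space G T) B"
  obtains V where "V \<in> open_normal_subgroups G T" "eq_mod V `` B \<subseteq> B"
proof -
  let ?O = "open_normal_subgroups G T"
  have B: "B \<subseteq> closed_subgroups G T"
    using assms(1) by (simp add: openin_subgroup_space)
  have "\<forall>H\<in>B. \<exists>V\<in>?O. subgroup_nbhd G T H V \<subseteq> B"
    using assms(1) by (simp add: openin_subgroup_space)
  then obtain v where v: "\<And>H. H \<in> B \<Longrightarrow> v H \<in> ?O" "\<And>H. H \<in> B \<Longrightarrow> subgroup_nbhd G T H (v H) \<subseteq> B"
    by metis
  have "compactin (subgroup_space G T) B"
    using assms(2) closedin_compact_space compact_subgroup_space by blast
  moreover have "openin (subgroup_space G T) U" if "U \<in> (\<lambda>H. subgroup_nbhd G T H (v H)) ` B" for U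
    using that v B openin_subgroup_nbhd by auto
  moreover have "B \<subseteq> \<Union>((\<lambda>H. subgroup_nbhd G T H (v H)) ` B)"
    using B by (auto simp: subgroup_nbhd_def)
  ultimately obtain \<F> where \<F>: "finite \<F>" "\<F> \<subseteq> (\<lambda>H. subgroup_nbhd G T H (v H)) ` B" "B \<subseteq> \<Union>\<F>"
    using compactinD[of "subgroup_space G T" B "(\<lambda>H. subgroup_nbhd G T H (v H)) ` B"] by blast
  obtain B0 where B0: "finite B0" "B0 \<subseteq> B" "\<F> = (\<lambda>H. subgroup_nbhd G T H (v H)) ` B0"
    using finite_subset_image[OF \<F>(1,2)] by blast
  define V where "V = \<Inter>(insert (carrier G) (v ` B0))"
  have V: "V \<in> ?O"
    unfolding V_def using B0 v carrier_open_normal by (intro open_normal_finite_Inter) auto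
  have "eq_mod V `` B \<subseteq> B"
  proof clarify
    fix H K assume HK: "(H, K) \<in> eq_mod V" "H \<in> B"
    then obtain L where L: "L \<in> B0" "H \<in> subgroup_nbhd G T L (v L)"
      using \<F>(3) B0(3) by auto
    have LB: "L \<in> B"
      using L B0 by blast
    have "eq_mod V \<subseteq> eq_mod (v L)"
      using open_normalD(2)[OF V] open_normalD(2)[OF v(1)[OF LB]] L(1)
      by (intro eq_mod_mono) (auto simp: V_def)
    with HK have "(H, K) \<in> eq_mod (v L)"
      by blast
    with L(2) have "K \<in> subgroup_nbhd G T L (v L)"
      by (simp add: subgroup_nbhd_def eq_mod_def)
    then show "K \<in> B"
      using v(2)[OF LB] by blast
  qed
  with V that show thesis
    by blast
qed

text \<open>If a subgroup \<open>L\<close> agrees modulo \<open>NM\<close> with \<open>H\<close>, then \<open>LN \<inter> HM\<close> agrees with \<open>L\<close> modulo \<open>N\<close> and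
  with \<open>H\<close> modulo \<open>M\<close>; it is the preimage of a fibre product of subgroups of \<open>G/N\<close> and \<open>G/M\<close>.  So if
  a set is saturated modulo \<open>M\<close>, its saturation modulo \<open>N\<close> is saturated modulo the open subgroup
  \<open>NM\<close>.\<close>

lemma eq_mod_open:
  assumes N: "N \<lhd> G" "closedin T N"
    and B: "openin (subgroup_space G T) B" "closedin (subgroup_space G T) B"
  shows "openin (subgroup_space G T) (eq_mod N `` B)" "closedin (subgroup_space G T) (eq_mod N `` B)"
proof -
  obtain M where M: "M \<in> open_normal_subgroups G T" and MB: "eq_mod M `` B \<subseteq> B"
    using clopen_imp_saturated[OF B] .
  note M' = open_normalD(1,2)[OF M] and N' = normal_imp_subgroup[OF N(1)]
  have NG: "N \<subseteq> carrier G" and MG: "M \<subseteq> carrier G"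
    using N' M' subgroup.subset by auto
  define V where "V = N <#> M"
  have V: "V \<in> open_normal_subgroups G T"
    using clopen_set_mult(1)[OF M NG] normal_subgroup_set_mult_closed[OF N(1) M'(1)]
    by (simp add: open_normal_subgroups_def V_def)
  have "eq_mod V `` (eq_mod N `` B) \<subseteq> eq_mod N `` B"
  proof clarify
    fix H K L assume HK: "(H, K) \<in> eq_mod N" "H \<in> B" and KL: "(K, L) \<in> eq_mod V"
    have H: "H \<in> closed_subgroups G T" and L: "L \<in> closed_subgroups G T"
      and "H <#> N = K <#> N" "K <#> V = L <#> V"
      using HK KL by (auto simp: eq_mod_def)
    note HG = closed_subgroupsD(3)[OF H] and LG = closed_subgroupsD(3)[OF L]
    have HL: "H <#> (N <#> M) = L <#> (N <#> M)"
    proof -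
      have "N \<subseteq> V"
        unfolding V_def by (rule subset_set_mult[OF NG M'(2)])
      then have "eq_mod N \<subseteq> eq_mod V"
        using N' open_normalD(2)[OF V] by (intro eq_mod_mono)
      then have "(H, K) \<in> eq_mod V"
        using HK by blast
      then show ?thesis
        using KL by (simp add: eq_mod_def V_def)
    qed
    have NM: "N <#> M = M <#> N"
      using commut_normal[OF N' M'(1)] .
    let ?P = "(L <#> N) \<inter> (H <#> M)"
    have P: "?P \<in> closed_subgroups G T"
      by (intro closed_subgroup_Int closed_subgroup_mult L H N M' open_normal_closed[OF M])
    have "?P <#> N = L <#> N"
    proof
      have "?P <#> N \<subseteq> L <#> N <#> N"
        by (rule set_mult_mono_left) blast
      also have "\<dots> = L <#> N"
        using set_mult_absorb_right[OF LG N' N'] by simp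
      finally show "?P <#> N \<subseteq> L <#> N" .
      show "L <#> N \<subseteq> ?P <#> N"
      proof
        fix x assume x: "x \<in> L <#> N"
        have "x \<in> L <#> N <#> M"
          using x subset_set_mult[OF set_mult_closed[OF LG NG] M'(2)] by blast
        also have "\<dots> = H <#> M <#> N"
          using HL NM set_mult_assoc[OF LG NG MG] set_mult_assoc[OF HG MG NG] by simp
        finally obtain y n where y: "y \<in> H <#> M" and n: "n \<in> N" and xy: "x = y \<otimes> n"
          by (auto simp: set_mult_def)
        have yG: "y \<in> carrier G" and nG: "n \<in> carrier G" and xG: "x \<in> carrier G"
          using y n NG x set_mult_closed[OF HG MG] set_mult_closed[OF LG NG] by auto
        have "y = x \<otimes> inv n"
          using xy yG nG by (simp add: m_assoc)
        also have "\<dots> \<in> L <#> N <#> N"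
          using x subgroup.m_inv_closed[OF N' n] by (rule set_mult_memI)
        also have "\<dots> = L <#> N"
          using set_mult_absorb_right[OF LG N' N'] by simp
        finally show "x \<in> ?P <#> N"
          using y n xy by (auto intro: set_mult_memI)
      qed
    qed
    moreover have "?P <#> M = H <#> M"
    proof
      have "?P <#> M \<subseteq> H <#> M <#> M"
        by (rule set_mult_mono_left) blast
      also have "\<dots> = H <#> M"
        using set_mult_absorb_right[OF HG M'(2) M'(2)] by simp
      finally show "?P <#> M \<subseteq> H <#> M" .
      show "H <#> M \<subseteq> ?P <#> M"
      proof
        fix x assume x: "x \<in> H <#> M"
        have "x \<in> H <#> M <#> N"
          using x subset_set_mult[OF set_mult_closed[OF HG MG] N'] by blast
        also have "\<dots> = L <#> N <#> M"
          using HL NM set_mult_assoc[OF LG NG MG] set_mult_assoc[OF HG MG NG] by simp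
        finally obtain y n where y: "y \<in> L <#> N" and n: "n \<in> M" and xy: "x = y \<otimes> n"
          by (auto simp: set_mult_def)
        have yG: "y \<in> carrier G" and nG: "n \<in> carrier G" and xG: "x \<in> carrier G"
          using y n MG x set_mult_closed[OF HG MG] set_mult_closed[OF LG NG] by auto
        have "y = x \<otimes> inv n"
          using xy yG nG by (simp add: m_assoc)
        also have "\<dots> \<in> H <#> M <#> M"
          using x subgroup.m_inv_closed[OF M'(2) n] by (rule set_mult_memI)
        also have "\<dots> = H <#> M"
          using set_mult_absorb_right[OF HG M'(2) M'(2)] by simp
        finally show "x \<in> ?P <#> M"
          using y n xy by (auto intro: set_mult_memI)
      qed
    qed
    ultimately have "(H, ?P) \<in> eq_mod M" "(?P, L) \<in> eq_mod N"
      using H L P by (auto simp: eq_mod_def)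
    then show "L \<in> eq_mod N `` B"
      using MB HK(2) by blast
  qed
  moreover have "eq_mod N `` B \<subseteq> closed_subgroups G T"
    by (auto simp: eq_mod_def)
  ultimately show "openin (subgroup_space G T) (eq_mod N `` B)"
      "closedin (subgroup_space G T) (eq_mod N `` B)"
    using saturated_clopen[OF V] by blast+
qed

end

section \<open>Independent clopen sets in a Boolean space\<close>

definition clopenin :: "'a topology \<Rightarrow> 'a set \<Rightarrow> bool" where
  "clopenin S b \<longleftrightarrow> openin S b \<and> closedin S b"

lemma clopenin_subset: "clopenin S b \<Longrightarrow> b \<subseteq> topspace S"
  by (simp add: clopenin_def openin_subset)

lemma clopenin_Un: "clopenin S a \<Longrightarrow> clopenin S b \<Longrightarrow> clopenin S (a \<union> b)"
  and clopenin_Int: "clopenin S a \<Longrightarrow> clopenin S b \<Longrightarrow> clopenin S (a \<inter> b)"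
  and clopenin_Diff: "clopenin S a \<Longrightarrow> clopenin S b \<Longrightarrow> clopenin S (a - b)"
  and clopenin_topspace: "clopenin S (topspace S)"
  and clopenin_empty: "clopenin S {}"
  by (auto simp: clopenin_def openin_diff closedin_diff)

text \<open>For the kernel \<^term>\<open>E\<close> of a continuous surjection between Boolean spaces, \<open>open_equiv\<close> says
  that the surjection is open, and \<open>perfect_equiv\<close> that its fibres have no isolated points.\<close>

definition open_equiv :: "'a topology \<Rightarrow> ('a \<times> 'a) set \<Rightarrow> bool" where
  "open_equiv S E \<longleftrightarrow> equiv (topspace S) E \<and> (\<forall>b. clopenin S b \<longrightarrow> clopenin S (E `` b))"

definition perfect_equiv :: "'a topology \<Rightarrow> ('a \<times> 'a) set \<Rightarrow> bool" where
  "perfect_equiv S E \<longleftrightarrow> (\<forall>b x. clopenin S b \<longrightarrow> x \<in> b \<longrightarrow> (\<exists>y\<in>b. y \<noteq> x \<and> (x, y) \<in> E))"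

definition splits :: "('a \<times> 'a) set \<Rightarrow> 'a set \<Rightarrow> 'a set \<Rightarrow> bool" where
  "splits E c M \<longleftrightarrow> (\<forall>x\<in>M. (\<exists>y. (x, y) \<in> E \<and> y \<in> c) \<and> (\<exists>y. (x, y) \<in> E \<and> y \<notin> c))"

definition agree_on :: "'a set set \<Rightarrow> ('a \<times> 'a) set" where
  "agree_on \<C> = {(x, y). \<forall>c\<in>\<C>. x \<in> c \<longleftrightarrow> y \<in> c}"

lemma agree_onD: "(x, y) \<in> agree_on \<C> \<Longrightarrow> c \<in> \<C> \<Longrightarrow> x \<in> c \<longleftrightarrow> y \<in> c"
  by (simp add: agree_on_def)

lemma agree_on_mono: "\<C> \<subseteq> \<C>' \<Longrightarrow> agree_on \<C>' \<subseteq> agree_on \<C>"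
  by (auto simp: agree_on_def)

lemma equiv_classD:
  assumes "equiv A E"
  shows "x \<in> A \<Longrightarrow> (x, x) \<in> E" "(x, y) \<in> E \<Longrightarrow> (y, x) \<in> E"
    "(x, y) \<in> E \<Longrightarrow> (y, z) \<in> E \<Longrightarrow> (x, z) \<in> E"
    "(x, y) \<in> E \<Longrightarrow> x \<in> A" "(x, y) \<in> E \<Longrightarrow> y \<in> A"
  using assms by (auto simp: equiv_def refl_on_def dest: symD transD)

definition split_part :: "'a topology \<Rightarrow> ('a \<times> 'a) set \<Rightarrow> 'a set \<Rightarrow> 'a set" where
  "split_part S E b = (E `` b) \<inter> (E `` (topspace S - b))"

lemma clopenin_split_part:
  assumes "open_equiv S E" "clopenin S b"
  shows "clopenin S (split_part S E b)"
  using assms unfolding split_part_def open_equiv_def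
  by (simp add: clopenin_Int clopenin_Diff clopenin_topspace)

text \<open>The set \<^term>\<open>split_part S E b\<close> is a union of classes of \<^term>\<open>E\<close>, so that two clopen sets
  may be glued along it: where \<^term>\<open>b\<close> splits the classes, \<^term>\<open>b\<close> itself is used, and
  \<^term>\<open>c\<close> elsewhere.\<close>

definition glue :: "'a topology \<Rightarrow> ('a \<times> 'a) set \<Rightarrow> 'a set \<Rightarrow> 'a set \<Rightarrow> 'a set" where
  "glue S E b c = (b \<inter> split_part S E b) \<union> (c - split_part S E b)"

lemma clopenin_glue:
  assumes "open_equiv S E" "clopenin S b" "clopenin S c"
  shows "clopenin S (glue S E b c)"
  using assms unfolding glue_def
  by (simp add: clopenin_Int clopenin_Diff clopenin_Un clopenin_split_part)

lemma split_part_saturated: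
  assumes "equiv (topspace S) E" "(x, y) \<in> E"
  shows "x \<in> split_part S E b \<longleftrightarrow> y \<in> split_part S E b"
  using equiv_classD(2,3)[OF assms(1)] assms(2) unfolding split_part_def by blast

lemma splits_glue:
  assumes E: "open_equiv S E" and b: "clopenin S b" and c: "splits E c M"
  shows "splits E (glue S E b c) (M \<union> split_part S E b)"
  unfolding splits_def
proof (intro ballI)
  have eq: "equiv (topspace S) E"
    using E by (simp add: open_equiv_def)
  fix x assume x: "x \<in> M \<union> split_part S E b"
  have iff: "y \<in> glue S E b c \<longleftrightarrow> (if x \<in> split_part S E b then y \<in> b else y \<in> c)"
    if "(x, y) \<in> E" for y
    using split_part_saturated[OF eq that] by (auto simp: glue_def)
  show "(\<exists>y. (x, y) \<in> E \<and> y \<in> glue S E b c) \<and> (\<exists>y. (x, y) \<in> E \<and> y \<notin> glue S E b c)"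
  proof (cases "x \<in> split_part S E b")
    case True
    then obtain y z where "(y, x) \<in> E" "y \<in> b" "(z, x) \<in> E" "z \<notin> b"
      unfolding split_part_def by blast
    then show ?thesis
      using iff[of y] iff[of z] equiv_classD(2)[OF eq] True by metis
  next
    case False
    with x have "x \<in> M"
      by blast
    then obtain y z where "(x, y) \<in> E" "y \<in> c" "(x, z) \<in> E" "z \<notin> c"
      using c unfolding splits_def by blast
    then show ?thesis
      using iff[of y] iff[of z] False by metis
  qed
qed

locale boolean_space =
  fixes S :: "'a topology"
  assumes compact: "compact_space S"
    and separated: "\<lbrakk>x \<in> topspace S; y \<in> topspace S; x \<noteq> y\<rbrakk> \<Longrightarrow> \<exists>b. clopenin S b \<and> x \<in> b \<and> y \<notin> b"
begin

text \<open>Each class is split by some clopen set, hence so are all classes near it, because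
  \<^term>\<open>split_part S E b\<close> is open.  Compactness leaves finitely many such sets to be glued.\<close>

lemma exists_splitting:
  assumes E: "open_equiv S E" and P: "perfect_equiv S E"
  shows "\<exists>c. clopenin S c \<and> splits E c (topspace S)"
proof -
  have eq: "equiv (topspace S) E"
    using E by (simp add: open_equiv_def)
  have "\<exists>b. clopenin S b \<and> x \<in> split_part S E b" if x: "x \<in> topspace S" for x
  proof -
    obtain y where y: "y \<in> topspace S" "y \<noteq> x" "(x, y) \<in> E"
      using P x clopenin_topspace[of S] unfolding perfect_equiv_def by blast
    then obtain b where b: "clopenin S b" "x \<in> b" "y \<notin> b"
      using separated[of x y] x by blast
    then have "x \<in> split_part S E b"
      using y equiv_classD(1,2)[OF eq] x unfolding split_part_def by blast
    with b show ?thesis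
      by blast
  qed
  then have "topspace S \<subseteq> \<Union>(split_part S E ` {b. clopenin S b})"
    by blast
  moreover have "openin S U" if "U \<in> split_part S E ` {b. clopenin S b}" for U
    using that clopenin_split_part[OF E] by (auto simp: clopenin_def)
  ultimately obtain \<F> where \<F>: "finite \<F>" "\<F> \<subseteq> split_part S E ` {b. clopenin S b}"
      "topspace S \<subseteq> \<Union>\<F>"
    using compact unfolding compact_space_alt by meson
  obtain \<B> where \<B>: "finite \<B>" "\<B> \<subseteq> {b. clopenin S b}" "\<F> = split_part S E ` \<B>"
    using finite_subset_image[OF \<F>(1,2)] by blast
  have "\<exists>c. clopenin S c \<and> splits E c (\<Union>(split_part S E ` \<B>))"
    using \<B>(1,2)
  proof (induction rule: finite_induct)
    case empty
    show ?case
      using clopenin_empty by (auto simp: splits_def)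
  next
    case (insert b \<B>)
    then obtain c where c: "clopenin S c" "splits E c (\<Union>(split_part S E ` \<B>))"
      by auto
    have b: "clopenin S b"
      using insert.prems by simp
    have "\<Union>(split_part S E ` insert b \<B>) = \<Union>(split_part S E ` \<B>) \<union> split_part S E b"
      by auto
    then show ?case
      using clopenin_glue[OF E b c(1)] splits_glue[OF E b c(2)] by metis
  qed
  then show ?thesis
    using \<F>(3) \<B>(3) unfolding splits_def by (meson subsetD)
qed

text \<open>A single new set suffices to capture \<^term>\<open>b\<close>: on the classes split by \<^term>\<open>b\<close> it is
  \<^term>\<open>b\<close>, and on the others, where \<^term>\<open>b\<close> is determined by the class, any splitting set will do.\<close>

lemma exists_splitting_determining:
  assumes E: "open_equiv S E" and P: "perfect_equiv S E" and b: "clopenin S b"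
  shows "\<exists>c. clopenin S c \<and> splits E c (topspace S) \<and>
    (\<forall>x y. (x, y) \<in> E \<longrightarrow> (x \<in> c \<longleftrightarrow> y \<in> c) \<longrightarrow> (x \<in> b \<longleftrightarrow> y \<in> b))"
proof -
  have eq: "equiv (topspace S) E"
    using E by (simp add: open_equiv_def)
  obtain c where c: "clopenin S c" "splits E c (topspace S)"
    using exists_splitting[OF E P] by blast
  have "x \<in> b \<longleftrightarrow> y \<in> b" if xy: "(x, y) \<in> E" "x \<in> glue S E b c \<longleftrightarrow> y \<in> glue S E b c" for x y
  proof (cases "x \<in> split_part S E b")
    case True
    then have "y \<in> split_part S E b"
      using split_part_saturated[OF eq xy(1)] by simp
    with True xy(2) show ?thesis
      by (simp add: glue_def)
  next
    case False
    have "x \<in> topspace S" "y \<in> topspace S" "(x, x) \<in> E" "(y, x) \<in> E"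
      using equiv_classD[OF eq] xy(1) by blast+
    with False show ?thesis
      unfolding split_part_def by blast
  qed
  moreover have "splits E (glue S E b c) (topspace S)"
    using splits_glue[OF E b c(2)] by (simp add: splits_def)
  ultimately show ?thesis
    using clopenin_glue[OF E b c(1)] by blast
qed

lemma open_equiv_refine:
  assumes E: "open_equiv S E" and c: "clopenin S c"
  shows "open_equiv S (E \<inter> agree_on {c})"
proof -
  have eq: "equiv (topspace S) E"
    using E by (simp add: open_equiv_def)
  have "equiv (topspace S) (E \<inter> agree_on {c})"
    using eq unfolding equiv_def refl_on_def sym_def trans_def agree_on_def by blast
  moreover have "clopenin S ((E \<inter> agree_on {c}) `` b)" if b: "clopenin S b" for b
  proof -
    have "(E \<inter> agree_on {c}) `` b = (E `` (b \<inter> c) \<inter> c) \<union> (E `` (b - c) - c)"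
      by (auto simp: agree_on_def)
    moreover have "clopenin S (E `` (b \<inter> c))" "clopenin S (E `` (b - c))"
      using E clopenin_Int[OF b c] clopenin_Diff[OF b c] by (simp_all add: open_equiv_def)
    ultimately show ?thesis
      using c by (simp add: clopenin_Un clopenin_Int clopenin_Diff)
  qed
  ultimately show ?thesis
    by (simp add: open_equiv_def)
qed

lemma perfect_equiv_refine:
  assumes P: "perfect_equiv S E" and c: "clopenin S c"
  shows "perfect_equiv S (E \<inter> agree_on {c})"
  unfolding perfect_equiv_def
proof (intro allI impI)
  fix b x assume b: "clopenin S b" and x: "x \<in> b"
  define d where "d = (if x \<in> c then b \<inter> c else b - c)"
  have "clopenin S d" "x \<in> d"
    using b c x by (auto simp: d_def clopenin_Int clopenin_Diff)
  then obtain y where "y \<in> d" "y \<noteq> x" "(x, y) \<in> E"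
    using P unfolding perfect_equiv_def by blast
  then show "\<exists>y\<in>b. y \<noteq> x \<and> (x, y) \<in> E \<inter> agree_on {c}"
    by (auto simp: d_def agree_on_def split: if_splits)
qed

lemma refine_finite:
  assumes "finite \<C>" "\<And>c. c \<in> \<C> \<Longrightarrow> clopenin S c" "open_equiv S E" "perfect_equiv S E"
  shows "open_equiv S (E \<inter> agree_on \<C>) \<and> perfect_equiv S (E \<inter> agree_on \<C>)"
  using assms(1,2)
proof (induction rule: finite_induct)
  case empty
  then show ?case
    using assms(3,4) by (simp add: agree_on_def)
next
  case (insert c \<C>)
  have "E \<inter> agree_on (insert c \<C>) = (E \<inter> agree_on \<C>) \<inter> agree_on {c}"
    by (auto simp: agree_on_def)
  then show ?case
    using insert open_equiv_refine[of "E \<inter> agree_on \<C>" c] perfect_equiv_refine[of "E \<inter> agree_on \<C>" c]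
    by simp
qed

definition independent_over :: "('a \<times> 'a) set \<Rightarrow> 'a set set \<Rightarrow> bool" where
  "independent_over E \<C> \<longleftrightarrow>
    (\<forall>x\<in>topspace S. \<forall>\<D>. \<exists>y. (x, y) \<in> E \<and> (\<forall>c\<in>\<C>. y \<in> c \<longleftrightarrow> c \<in> \<D>))"

lemma independent_over_insert:
  assumes eq: "equiv (topspace S) E" and ind: "independent_over E \<C>"
    and c: "splits (E \<inter> agree_on \<C>) c (topspace S)"
  shows "independent_over E (insert c \<C>)"
  unfolding independent_over_def
proof (intro ballI allI)
  fix x \<D> assume "x \<in> topspace S"
  then obtain y where y: "(x, y) \<in> E" "\<forall>c\<in>\<C>. y \<in> c \<longleftrightarrow> c \<in> \<D>"
    using ind unfolding independent_over_def by blast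
  have "y \<in> topspace S"
    using equiv_classD(5)[OF eq y(1)] .
  then obtain z where z: "(y, z) \<in> E \<inter> agree_on \<C>" "z \<in> c \<longleftrightarrow> c \<in> \<D>"
    using c unfolding splits_def by (cases "c \<in> \<D>") blast+
  then show "\<exists>z. (x, z) \<in> E \<and> (\<forall>c\<in>insert c \<C>. z \<in> c \<longleftrightarrow> c \<in> \<D>)"
    using y equiv_classD(3)[OF eq] by (intro exI[of _ z]) (auto simp: agree_on_def)
qed

text \<open>The members of \<^term>\<open>\<B>\<close> are captured one at a time, each over the equivalence relation
  refined by all sets chosen before.\<close>

lemma extend_independent_over:
  assumes E: "open_equiv S E" and P: "perfect_equiv S E"
    and \<C>: "finite \<C>" "\<And>c. c \<in> \<C> \<Longrightarrow> clopenin S c" "independent_over E \<C>"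
    and \<B>: "finite \<B>" "\<And>b. b \<in> \<B> \<Longrightarrow> clopenin S b"
  shows "\<exists>\<C>'. \<C> \<subseteq> \<C>' \<and> finite \<C>' \<and> (\<forall>c\<in>\<C>'. clopenin S c) \<and> independent_over E \<C>' \<and>
    E \<inter> agree_on \<C>' \<subseteq> agree_on \<B>"
  using \<B>
proof (induction rule: finite_induct)
  case empty
  then show ?case
    using \<C> by (intro exI[of _ \<C>]) (auto simp: agree_on_def)
next
  case (insert b \<B>)
  then obtain \<C>' where C': "\<C> \<subseteq> \<C>'" "finite \<C>'" "\<forall>c\<in>\<C>'. clopenin S c" "independent_over E \<C>'"
      "E \<inter> agree_on \<C>' \<subseteq> agree_on \<B>"
    by auto
  have ref: "open_equiv S (E \<inter> agree_on \<C>')" "perfect_equiv S (E \<inter> agree_on \<C>')"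
    using refine_finite[OF C'(2) _ E P] C'(3) by auto
  have "clopenin S b"
    using insert.prems by simp
  then obtain c where c: "clopenin S c" "splits (E \<inter> agree_on \<C>') c (topspace S)"
      "\<forall>x y. (x, y) \<in> E \<inter> agree_on \<C>' \<longrightarrow> (x \<in> c \<longleftrightarrow> y \<in> c) \<longrightarrow> (x \<in> b \<longleftrightarrow> y \<in> b)"
    using exists_splitting_determining[OF ref] by metis
  have "independent_over E (insert c \<C>')"
    using independent_over_insert[OF _ C'(4) c(2)] E by (simp add: open_equiv_def)
  moreover have "E \<inter> agree_on (insert c \<C>') \<subseteq> agree_on (insert b \<B>)"
  proof clarify
    fix x y assume xy: "(x, y) \<in> E" "(x, y) \<in> agree_on (insert c \<C>')"
    then have "(x, y) \<in> E \<inter> agree_on \<C>'" "x \<in> c \<longleftrightarrow> y \<in> c"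
      by (auto simp: agree_on_def)
    then have "(x, y) \<in> agree_on \<B>" "x \<in> b \<longleftrightarrow> y \<in> b"
      using subsetD[OF C'(5)] c(3)[rule_format, of x y] by simp_all
    then show "(x, y) \<in> agree_on (insert b \<B>)"
      by (simp add: agree_on_def)
  qed
  ultimately show ?case
    using C'(1-3) c(1) by (intro exI[of _ "insert c \<C>'"]) auto
qed

definition independent :: "'a set set \<Rightarrow> bool" where
  "independent \<C> \<longleftrightarrow> (\<forall>\<D>. \<exists>x\<in>topspace S. \<forall>c\<in>\<C>. x \<in> c \<longleftrightarrow> c \<in> \<D>)"

lemma independent_mono: "independent \<C> \<Longrightarrow> \<C>' \<subseteq> \<C> \<Longrightarrow> independent \<C>'"
  unfolding independent_def by (meson subsetD)

text \<open>Every truth assignment is a family of closed conditions, so compactness reduces its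
  realizability to finite subfamilies.\<close>

lemma independentI_finite:
  assumes clo: "\<And>c. c \<in> \<C> \<Longrightarrow> clopenin S c"
    and fin: "\<And>\<C>'. \<lbrakk>finite \<C>'; \<C>' \<subseteq> \<C>\<rbrakk> \<Longrightarrow> independent \<C>'"
  shows "independent \<C>"
  unfolding independent_def
proof
  fix \<D>
  define f where "f c = (if c \<in> \<D> then topspace S \<inter> c else topspace S - c)" for c
  have f: "x \<in> f c \<longleftrightarrow> x \<in> topspace S \<and> (x \<in> c \<longleftrightarrow> c \<in> \<D>)" for x c
    by (auto simp: f_def)
  let ?\<U> = "insert (topspace S) (f ` \<C>)"
  have "closedin S D" if "D \<in> ?\<U>" for D
  proof -
    have "closedin S (f c)" if "c \<in> \<C>" for c
      using clo[OF that] by (auto simp: f_def clopenin_def)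
    then show ?thesis
      using that by auto
  qed
  moreover have "\<Inter>\<F> \<noteq> {}" if \<F>: "finite \<F>" "\<F> \<subseteq> ?\<U>" for \<F>
  proof -
    have "finite (\<F> - {topspace S})" "\<F> - {topspace S} \<subseteq> f ` \<C>"
      using \<F> by auto
    then obtain \<C>' where C': "finite \<C>'" "\<C>' \<subseteq> \<C>" "\<F> - {topspace S} = f ` \<C>'"
      using finite_subset_image by metis
    obtain x where x: "x \<in> topspace S" "\<forall>c\<in>\<C>'. x \<in> c \<longleftrightarrow> c \<in> \<D>"
      using fin[OF C'(1,2)] unfolding independent_def by blast
    have "x \<in> D" if "D \<in> \<F>" for D
    proof (cases "D = topspace S")
      case False
      then have "D \<in> f ` \<C>'"
        using that C'(3) by blast
      then show ?thesis
        using x f by auto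
    qed (use x in simp)
    then show ?thesis
      by blast
  qed
  ultimately have "\<Inter>?\<U> \<noteq> {}"
    using compact unfolding compact_space_fip by (metis (no_types, lifting))
  then obtain x where "x \<in> topspace S" "\<forall>c\<in>\<C>. x \<in> f c"
    by auto
  then show "\<exists>x\<in>topspace S. \<forall>c\<in>\<C>. x \<in> c \<longleftrightarrow> c \<in> \<D>"
    using f by blast
qed

lemma independent_Union_chain:
  assumes chain: "subset.chain UNIV \<K>" "\<K> \<noteq> {}"
    and \<K>: "\<And>\<C>. \<C> \<in> \<K> \<Longrightarrow> independent \<C>" "\<And>\<C> c. \<C> \<in> \<K> \<Longrightarrow> c \<in> \<C> \<Longrightarrow> clopenin S c"
  shows "independent (\<Union>\<K>)"
proof (rule independentI_finite)
  fix \<C>' assume "finite \<C>'" "\<C>' \<subseteq> \<Union>\<K>"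
  then obtain \<C> where "\<C> \<in> \<K>" "\<C>' \<subseteq> \<C>"
    using finite_subset_Union_chain[OF _ _ chain(2,1)] by blast
  then show "independent \<C>'"
    using \<K>(1) independent_mono by blast
qed (use \<K>(2) in blast)

text \<open>Evaluation of the members of the family is onto by independence and injective by separation, and
  a continuous bijection from a compact space to a Hausdorff space is a homeomorphism.\<close>

lemma homeomorphic_cube:
  assumes clo: "\<And>c. c \<in> \<C> \<Longrightarrow> clopenin S c" and ind: "independent \<C>"
    and sep: "\<And>x y. \<lbrakk>x \<in> topspace S; y \<in> topspace S; (x, y) \<in> agree_on \<C>\<rbrakk> \<Longrightarrow> x = y"
    and h: "bij_betw h I \<C>"
  shows "S homeomorphic_space product_topology (\<lambda>_. discrete_topology (UNIV :: bool set)) I"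
proof -
  let ?P = "product_topology (\<lambda>_. discrete_topology (UNIV :: bool set)) I"
  define f where "f x = restrict (\<lambda>i. x \<in> h i) I" for x
  have hI: "i \<in> I \<Longrightarrow> h i \<in> \<C>" for i
    using h by (auto simp: bij_betw_def)
  have "continuous_map S ?P f"
    unfolding continuous_map_componentwise
  proof (intro conjI ballI)
    show "f ` topspace S \<subseteq> extensional I"
      by (auto simp: f_def)
    fix i assume i: "i \<in> I"
    have clo_i: "openin S (h i)" "openin S (topspace S - h i)" "h i \<subseteq> topspace S"
      using clo[OF hI[OF i]] by (auto simp: clopenin_def openin_diff dest: openin_subset)
    show "continuous_map S (discrete_topology UNIV) (\<lambda>x. f x i)"
    proof (clarsimp simp: continuous_map_def)
      fix U :: "bool set"
      have "{x \<in> topspace S. f x i \<in> U} =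
          (if True \<in> U then h i else {}) \<union> (if False \<in> U then topspace S - h i else {})"
        using i clo_i(3) by (auto simp: f_def) (metis (full_types))+
      also have "openin S \<dots>"
        using clo_i by auto
      finally show "openin S {x \<in> topspace S. f x i \<in> U}" .
    qed
  qed
  moreover have "f ` topspace S = topspace ?P"
  proof
    show "f ` topspace S \<subseteq> topspace ?P"
      by (auto simp: f_def)
    show "topspace ?P \<subseteq> f ` topspace S"
    proof
      fix e assume e: "e \<in> topspace ?P"
      obtain x where x: "x \<in> topspace S" "\<forall>c\<in>\<C>. x \<in> c \<longleftrightarrow> c \<in> h ` {i \<in> I. e i}"
        using ind unfolding independent_def by blast
      have "x \<in> h i \<longleftrightarrow> e i" if i: "i \<in> I" for i
      proof -
        have "h i \<in> h ` {i \<in> I. e i} \<longleftrightarrow> e i"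
          using h i by (auto simp: bij_betw_def inj_on_def)
        then show ?thesis
          using x(2) hI[OF i] by simp
      qed
      then have "f x = e"
        using e by (auto simp: f_def PiE_iff extensional_def fun_eq_iff)
      then show "e \<in> f ` topspace S"
        using x(1) by blast
    qed
  qed
  moreover have "inj_on f (topspace S)"
  proof (rule inj_onI)
    fix x y assume xy: "x \<in> topspace S" "y \<in> topspace S" "f x = f y"
    have "x \<in> h i \<longleftrightarrow> y \<in> h i" if "i \<in> I" for i
      using fun_cong[OF xy(3), of i] that by (simp add: f_def)
    then have "(x, y) \<in> agree_on \<C>"
      using h by (auto simp: agree_on_def bij_betw_def)
    with sep xy(1,2) show "x = y"
      by blast
  qed
  moreover have "Hausdorff_space ?P"
    by (simp add: Hausdorff_space_product_topology)
  ultimately show ?thesis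
    using continuous_imp_homeomorphic_map compact homeomorphic_map_imp_homeomorphic_space by blast
qed

end

section \<open>Proper supplements of kernels of metrizable quotients\<close>

context topological_group
begin

text \<open>These are the closed normal subgroups with metrizable quotient.\<close>

definition countably_cut :: "'a set \<Rightarrow> bool" where
  "countably_cut N \<longleftrightarrow>
    (\<exists>\<V>. countable \<V> \<and> \<V> \<noteq> {} \<and> \<V> \<subseteq> open_normal_subgroups G T \<and> N = \<Inter>\<V>)"

lemma countably_cutD:
  assumes "countably_cut N"
  shows "N \<lhd> G" "subgroup N G" "closedin T N"
proof -
  obtain \<V> where \<V>: "\<V> \<noteq> {}" "\<V> \<subseteq> open_normal_subgroups G T" "N = \<Inter>\<V>"
    using assms by (auto simp: countably_cut_def)
  show "N \<lhd> G"
    unfolding \<V>(3) using \<V>(2) open_normalD(1) by (intro normal_Inter[OF \<V>(1)]) blast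
  then show "subgroup N G"
    by (rule normal_imp_subgroup)
  show "closedin T N"
    unfolding \<V>(3) using \<V>(2) open_normal_closed by (intro closedin_Inter[OF \<V>(1)]) blast
qed

lemma countably_cut_Inter:
  assumes "countable \<N>" "\<N> \<noteq> {}" "\<And>N. N \<in> \<N> \<Longrightarrow> countably_cut N"
  shows "countably_cut (\<Inter>\<N>)"
proof -
  obtain v where v: "\<And>N. N \<in> \<N> \<Longrightarrow> countable (v N)" "\<And>N. N \<in> \<N> \<Longrightarrow> v N \<noteq> {}"
      "\<And>N. N \<in> \<N> \<Longrightarrow> v N \<subseteq> open_normal_subgroups G T" "\<And>N. N \<in> \<N> \<Longrightarrow> N = \<Inter>(v N)"
    using assms(3) unfolding countably_cut_def by metis
  have "\<Inter>\<N> = \<Inter>(\<Union>(v ` \<N>))"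
    using v(4) by blast
  moreover have "countable (\<Union>(v ` \<N>))"
    using assms(1) v(1) by blast
  moreover have "\<Union>(v ` \<N>) \<noteq> {}"
    using assms(2) v(2) by blast
  moreover have "\<Union>(v ` \<N>) \<subseteq> open_normal_subgroups G T"
    using v(3) by blast
  ultimately show ?thesis
    unfolding countably_cut_def by blast
qed

lemma open_normal_countably_cut: "V \<in> open_normal_subgroups G T \<Longrightarrow> countably_cut V"
  unfolding countably_cut_def by (intro exI[of _ "{V}"]) auto

lemma countably_cut_sequence:
  assumes "countably_cut N"
  obtains W where "\<And>n::nat. W n \<in> open_normal_subgroups G T" "decseq W" "N = (\<Inter>n. W n)"
proof -
  obtain \<V> where \<V>: "countable \<V>" "\<V> \<noteq> {}" "\<V> \<subseteq> open_normal_subgroups G T" "N = \<Inter>\<V>"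
    using assms by (auto simp: countably_cut_def)
  define W where "W n = \<Inter>(from_nat_into \<V> ` {..n})" for n
  have range: "range (from_nat_into \<V>) = \<V>"
    using \<V>(1,2) by (simp add: range_from_nat_into)
  have "W n \<in> open_normal_subgroups G T" for n
    unfolding W_def using \<V>(3) range by (intro open_normal_finite_Inter) auto
  moreover have "decseq W"
    unfolding W_def decseq_def by force
  moreover have "N = (\<Inter>n. W n)"
    unfolding \<V>(4) W_def by (subst range[symmetric]) blast
  ultimately show thesis
    by (rule that)
qed

end

context profinite_group
begin

text \<open>A closed set that meets each coset of \<^term>\<open>N\<close> in a coset of a subgroup \<open>R\<close> can be
  thinned out, by choosing one coset of an open normal subgroup \<open>V\<close> in each coset of \<open>RV\<close>,
  so that \<open>R\<close> shrinks to \<open>R \<inter> V\<close>.  Compactness allows to pass to intersections of chains, and in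
  a minimal set of this kind \<open>R\<close> is trivial.\<close>

lemma closed_transversal:
  assumes N: "subgroup N G" "closedin T N"
  obtains A where "closedin T A" "\<And>g. g \<in> carrier G \<Longrightarrow> \<exists>n\<in>N. g \<otimes> n \<in> A"
    "\<And>t r. \<lbrakk>t \<in> A; r \<in> N; t \<otimes> r \<in> A\<rbrakk> \<Longrightarrow> r = \<one>"
proof -
  note NG = subgroup.subset[OF N(1)]
  define cover where "cover A \<longleftrightarrow> (\<forall>g\<in>carrier G. \<exists>n\<in>N. g \<otimes> n \<in> A)" for A
  define fib where "fib A R \<longleftrightarrow> subgroup R G \<and> R \<subseteq> N \<and> (\<forall>t\<in>A. \<forall>r\<in>N. t \<otimes> r \<in> A \<longleftrightarrow> r \<in> R)" for A R
  define \<T> where "\<T> = {A. closedin T A \<and> cover A \<and> (\<exists>R. fib A R)}"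
  have \<T>_sub: "A \<subseteq> carrier G" if "A \<in> \<T>" for A
    using that closedin_subset topspace_eq by (auto simp: \<T>_def)
  let ?P = "\<lambda>A B. B \<subseteq> A"
  have "\<exists>A\<in>\<T>. \<forall>B\<in>\<T>. B \<subseteq> A \<longrightarrow> B = A"
  proof (rule predicate_Zorn)
    show "partial_order_on \<T> (relation_of ?P \<T>)"
      by (rule partial_order_on_relation_ofI) auto
  next
    fix \<C> assume "\<C> \<in> Chains (relation_of ?P \<T>)"
    then have chain: "A \<subseteq> B \<or> B \<subseteq> A" and \<C>: "A \<in> \<T>" if "A \<in> \<C>" "B \<in> \<C>" for A B
      using that by (auto simp: Chains_def relation_of_def)
    show "\<exists>U\<in>\<T>. \<forall>A\<in>\<C>. U \<subseteq> A"
    proof (cases "\<C> = {}")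
      case True
      have "closedin T (carrier G)"
        using closedin_topspace[of T] by (simp add: topspace_eq)
      moreover have "cover (carrier G)"
        unfolding cover_def using subgroup.one_closed[OF N(1)] by (auto intro!: bexI[of _ \<one>])
      moreover have "fib (carrier G) N"
        unfolding fib_def using N(1) NG by auto
      ultimately have "carrier G \<in> \<T>"
        by (auto simp: \<T>_def)
      with True show ?thesis
        by blast
    next
      case False
      have "\<exists>R. fib A R" if "A \<in> \<C>" for A
        using \<C>[OF that that] by (simp add: \<T>_def)
      then obtain R where R: "\<And>A. A \<in> \<C> \<Longrightarrow> fib A (R A)"
        by metis
      have clo: "closedin T A" "cover A" if "A \<in> \<C>" for A
        using \<C>[OF that that] by (auto simp: \<T>_def)
      have dir: "down_directed \<C>"
        using False chain unfolding down_directed_def by (metis inf.absorb1 inf.absorb2 order_refl)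
      have "closedin T (\<Inter>\<C>)"
        using False clo by (intro closedin_Inter) auto
      moreover have "cover (\<Inter>\<C>)"
        unfolding cover_def
      proof
        fix g assume g: "g \<in> carrier G"
        let ?f = "\<lambda>A. N \<inter> {n \<in> topspace T. g \<otimes> n \<in> A}"
        have cont: "continuous_map T T (\<lambda>n. g \<otimes> n)"
          using g by (intro continuous_map_mult continuous_map_constant) auto
        have "\<Inter>(?f ` \<C>) \<noteq> {}"
        proof (rule compact_directed_Inter_nonempty[OF compact])
          show "down_directed (?f ` \<C>)"
            by (rule down_directed_image[OF dir]) auto
          fix D assume "D \<in> ?f ` \<C>"
          then show "closedin T D"
            using N(2) clo(1) closedin_continuous_map_preimage[OF cont] by auto
        next
          have "?f A \<noteq> {}" if "A \<in> \<C>" for A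
            using clo(2)[OF that] g NG by (auto simp: cover_def topspace_eq)
          then show "{} \<notin> ?f ` \<C>"
            by (metis (no_types, lifting) imageE)
        qed
        then show "\<exists>n\<in>N. g \<otimes> n \<in> \<Inter>\<C>"
          using False by auto
      qed
      moreover have "fib (\<Inter>\<C>) (\<Inter>(R ` \<C>))"
      proof -
        have "subgroup (\<Inter>(R ` \<C>)) G"
          using False R by (intro subgroups_Inter) (auto simp: fib_def)
        moreover have "\<Inter>(R ` \<C>) \<subseteq> N"
        proof -
          obtain A where "A \<in> \<C>"
            using False by blast
          with R[OF this] show ?thesis
            by (auto simp: fib_def)
        qed
        moreover have "t \<otimes> r \<in> \<Inter>\<C> \<longleftrightarrow> r \<in> \<Inter>(R ` \<C>)" if "t \<in> \<Inter>\<C>" "r \<in> N" for t r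
          using that R by (auto simp: fib_def)
        ultimately show ?thesis
          by (simp add: fib_def)
      qed
      ultimately have "\<Inter>\<C> \<in> \<T>"
        by (auto simp: \<T>_def)
      then show ?thesis
        by blast
    qed
  qed
  then obtain A where A: "A \<in> \<T>" and minimal: "\<And>B. B \<in> \<T> \<Longrightarrow> B \<subseteq> A \<Longrightarrow> B = A"
    by blast
  obtain R where R: "subgroup R G" "R \<subseteq> N" "\<And>t r. \<lbrakk>t \<in> A; r \<in> N\<rbrakk> \<Longrightarrow> t \<otimes> r \<in> A \<longleftrightarrow> r \<in> R"
    using A by (auto simp: \<T>_def fib_def)
  have AG: "A \<subseteq> carrier G" and RG: "R \<subseteq> carrier G"
    using \<T>_sub[OF A] subgroup.subset[OF R(1)] .
  have A_cover: "cover A" and A_closed: "closedin T A"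
    using A by (auto simp: \<T>_def)
  have "r = \<one>" if r: "r \<in> R" for r
  proof (rule ccontr)
    assume "r \<noteq> \<one>"
    then obtain V where V: "V \<in> open_normal_subgroups G T" and rV: "r \<notin> V"
      using Inter_open_normal by blast
    note V' = open_normalD(2)[OF V] and VG = open_normalD(4)[OF V]
    define Q where "Q = R <#> V"
    have Q: "subgroup Q G"
      unfolding Q_def commut_normal[OF R(1) open_normalD(1)[OF V]]
      using open_normalD(1)[OF V] R(1) by (rule mult_norm_subgroup)
    have VQ: "V \<subseteq> Q" and RQ: "R \<subseteq> Q"
      using set_mult_memI[OF subgroup.one_closed[OF R(1)], of _ V] VG
        subset_set_mult[OF RG V'] by (auto simp: Q_def subsetD)
    define rep where "rep x = (SOME y. y \<in> x <# Q)" for x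
    have rep: "rep x \<in> carrier G" "inv x \<otimes> rep x \<in> Q" if x: "x \<in> carrier G" for x
    proof -
      have "x \<in> x <# Q"
        using x subgroup.one_closed[OF Q] by (simp add: mem_l_coset_iff[OF x Q])
      then have "rep x \<in> x <# Q"
        unfolding rep_def by (rule someI)
      then show "rep x \<in> carrier G" "inv x \<otimes> rep x \<in> Q"
        by (simp_all add: mem_l_coset_iff[OF x Q])
    qed
    have rep_eq: "rep x = rep y" if "x \<in> carrier G" "y \<in> carrier G" "inv x \<otimes> y \<in> Q" for x y
      using that by (simp add: rep_def l_coset_eq_iff[OF that(1,2) Q, THEN iffD2])
    \<comment> \<open>From each coset of \<^term>\<open>Q\<close>, the coset of \<^term>\<open>V\<close> through its representative is kept.\<close>
    define Y where "Y = {x \<in> carrier G. inv (rep x) \<otimes> x \<in> V}"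
    have "closedin T Y"
    proof (rule closedin_saturated[OF V])
      fix a b assume ab: "a \<in> Y" "b \<in> carrier G" "inv a \<otimes> b \<in> V"
      then have a: "a \<in> carrier G" "inv (rep a) \<otimes> a \<in> V"
        by (auto simp: Y_def)
      have "inv (rep a) \<otimes> b = (inv (rep a) \<otimes> a) \<otimes> (inv a \<otimes> b)"
        using a ab(2) rep(1)[OF a(1)] by (simp add: m_assoc mult_inv_cancel)
      also have "\<dots> \<in> V"
        by (rule subgroup.m_closed[OF V' a(2) ab(3)])
      finally show "b \<in> Y"
        using rep_eq[of a b] a(1) ab VQ by (auto simp: Y_def)
    qed (auto simp: Y_def)
    define B where "B = A \<inter> Y"
    have tr: "t \<otimes> s \<in> carrier G" "rep (t \<otimes> s) = rep t" if "t \<in> carrier G" "s \<in> R" for t s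
    proof -
      have s: "s \<in> carrier G" "s \<in> Q"
        using that RG RQ by auto
      then show "t \<otimes> s \<in> carrier G"
        using that by simp
      then show "rep (t \<otimes> s) = rep t"
        using rep_eq[of t "t \<otimes> s"] that s by (simp add: mult_inv_cancel)
    qed
    have "cover B"
      unfolding cover_def
    proof
      fix g assume g: "g \<in> carrier G"
      then obtain n where n: "n \<in> N" "g \<otimes> n \<in> A"
        using A_cover by (auto simp: cover_def)
      define t where "t = g \<otimes> n"
      have t: "t \<in> A" "t \<in> carrier G"
        using n AG by (auto simp: t_def)
      obtain s v where s: "s \<in> R" "v \<in> V" "inv t \<otimes> rep t = s \<otimes> v"
        using rep(2)[OF t(2)] by (auto simp: Q_def set_mult_def)
      have G: "s \<in> carrier G" "v \<in> carrier G" "n \<in> carrier G"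
        using s n RG VG NG by auto
      have "rep t = t \<otimes> (inv t \<otimes> rep t)"
        using rep(1)[OF t(2)] t(2) by (simp add: mult_inv_cancel)
      then have "rep t = t \<otimes> s \<otimes> v"
        using s(3) t(2) G by (simp add: m_assoc)
      then have "inv (rep (t \<otimes> s)) \<otimes> (t \<otimes> s) = inv v"
        using tr(2)[OF t(2) s(1)] t(2) G
        by (simp add: inv_mult_group m_assoc mult_inv_cancel)
      then have "t \<otimes> s \<in> Y"
        using tr(1)[OF t(2) s(1)] subgroup.m_inv_closed[OF V' s(2)] by (simp add: Y_def)
      moreover have "t \<otimes> s \<in> A"
        using R(3)[OF t(1)] s(1) R(2) by blast
      moreover have "t \<otimes> s = g \<otimes> (n \<otimes> s)"
        using g G by (simp add: t_def m_assoc)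
      moreover have "n \<otimes> s \<in> N"
        using subgroup.m_closed[OF N(1) n(1)] s(1) R(2) by blast
      ultimately show "\<exists>n\<in>N. g \<otimes> n \<in> B"
        by (auto simp: B_def)
    qed
    moreover have "fib B (R \<inter> V)"
    proof -
      have "t \<otimes> s \<in> B \<longleftrightarrow> s \<in> R \<inter> V" if t: "t \<in> B" and s: "s \<in> N" for t s
      proof -
        have tA: "t \<in> A" "t \<in> carrier G" "inv (rep t) \<otimes> t \<in> V"
          using t AG by (auto simp: B_def Y_def)
        have sG: "s \<in> carrier G"
          using s NG by blast
        have "t \<otimes> s \<in> Y \<longleftrightarrow> s \<in> V" if sR: "s \<in> R"
        proof -
          let ?u = "inv (rep t) \<otimes> t"
          have uG: "?u \<in> carrier G"
            using tA(3) VG by blast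
          have "t \<otimes> s \<in> Y \<longleftrightarrow> ?u \<otimes> s \<in> V"
            using tr[OF tA(2) sR] rep(1)[OF tA(2)] tA(2) sG by (simp add: Y_def m_assoc)
          also have "\<dots> \<longleftrightarrow> s \<in> V"
          proof
            assume "?u \<otimes> s \<in> V"
            then have "inv ?u \<otimes> (?u \<otimes> s) \<in> V"
              by (rule subgroup.m_closed[OF V' subgroup.m_inv_closed[OF V' tA(3)]])
            then show "s \<in> V"
              using uG sG by (simp only: mult_inv_cancel)
          qed (rule subgroup.m_closed[OF V' tA(3)])
          finally show ?thesis .
        qed
        then show ?thesis
          using R(3)[OF tA(1) s] by (auto simp: B_def)
      qed
      then show ?thesis
        using R(1,2) V' subgroups_Inter_pair by (auto simp: fib_def)
    qed
    moreover have "closedin T B"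
      unfolding B_def by (intro closedin_Int A_closed \<open>closedin T Y\<close>)
    ultimately have "B \<in> \<T>"
      by (auto simp: \<T>_def)
    then have "B = A"
      using minimal by (simp add: B_def)
    obtain t where "t \<in> A"
      using A_cover by (auto simp: cover_def)
    then have "t \<otimes> r \<in> B" "t \<in> B"
      using R(2,3) r \<open>B = A\<close> by blast+
    then have "r \<in> V"
      using \<open>fib B (R \<inter> V)\<close> r R(2) by (auto simp: fib_def)
    with rV show False ..
  qed
  then show thesis
    using that[OF A_closed] A_cover R(3) by (auto simp: cover_def)
qed

text \<open>A transversal of \<^term>\<open>N\<close> is homeomorphic to the quotient by \<^term>\<open>N\<close>, so each of its clopen
  partitions is coarser than the one induced by some \<^term>\<open>W k\<close>.  In terms of sets: the closed
  conditions violating this for \<^term>\<open>k\<close> decrease with \<^term>\<open>k\<close>, and a common point would be a pair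
  of distinct elements of the transversal in one coset of \<^term>\<open>N\<close>.\<close>

lemma transversal_uniform:
  assumes A: "closedin T A" "\<And>t r. \<lbrakk>t \<in> A; r \<in> N; t \<otimes> r \<in> A\<rbrakk> \<Longrightarrow> r = \<one>"
    and W: "\<And>n::nat. W n \<in> open_normal_subgroups G T" "decseq W" "N = (\<Inter>n. W n)"
    and V: "V \<in> open_normal_subgroups G T"
  shows "\<exists>k. \<forall>s\<in>A. \<forall>t\<in>A. inv s \<otimes> t \<in> W k \<longrightarrow> inv s \<otimes> t \<in> V"
proof (rule ccontr)
  assume "\<not> ?thesis"
  then have no: "\<exists>s\<in>A. \<exists>t\<in>A. inv s \<otimes> t \<in> W k \<and> inv s \<otimes> t \<notin> V" for k
    by blast
  have AG: "A \<subseteq> carrier G"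
    using A(1) closedin_subset topspace_eq by auto
  let ?Z = "prod_topology T T"
  define D where "D k = (A \<times> A) \<inter> {p \<in> topspace ?Z. inv (fst p) \<otimes> snd p \<in> W k - V}" for k
  have cont: "continuous_map ?Z T (\<lambda>p. inv (fst p) \<otimes> snd p)"
    by (intro continuous_map_mult continuous_map_inverse continuous_map_fst continuous_map_snd)
  have "\<Inter>(range D) \<noteq> {}"
  proof (rule compact_directed_Inter_nonempty)
    show "compact_space ?Z"
      using compact by (simp add: compact_space_prod_topology)
    show "down_directed (range D)"
      using W(2) by (intro down_directed_decseq) (auto simp: D_def decseq_def)
    fix C assume "C \<in> range D"
    then obtain k where "C = D k"
      by blast
    moreover have "closedin T (W k - V)"
      using open_normal_closed[OF W(1)] open_normalD(3)[OF V] by (intro closedin_diff)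
    moreover have "closedin ?Z (A \<times> A)"
      using A(1) by (simp add: closedin_prod_Times_iff)
    ultimately show "closedin ?Z C"
      unfolding D_def by (simp only:) (intro closedin_Int closedin_continuous_map_preimage[OF cont])
  next
    have "D k \<noteq> {}" for k
      using no[of k] AG by (fastforce simp: D_def topspace_eq)
    then show "{} \<notin> range D"
      unfolding image_iff by (metis (no_types))
  qed
  then obtain s t where st: "\<And>k. (s, t) \<in> D k"
    by auto
  then have "s \<in> A" "t \<in> A" "inv s \<otimes> t \<in> N" "inv s \<otimes> t \<notin> V"
    by (auto simp: D_def W(3))
  moreover have "s \<otimes> (inv s \<otimes> t) = t"
    using AG \<open>s \<in> A\<close> \<open>t \<in> A\<close> by (intro mult_inv_cancel) auto
  ultimately have "inv s \<otimes> t = \<one>"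
    using A(2)[of s "inv s \<otimes> t"] by simp
  then show False
    using \<open>inv s \<otimes> t \<notin> V\<close> open_normalD(5)[OF V] by simp
qed

end

context topological_group
begin

fun letter :: "bool \<times> 'a \<Rightarrow> 'a" where
  "letter (b, t) = (if b then t else inv t)"

definition word_value :: "(bool \<times> 'a) list \<Rightarrow> 'a" where
  "word_value w = foldr (\<lambda>p g. letter p \<otimes> g) w \<one>"

lemma word_value_simps [simp]:
  "word_value [] = \<one>" "word_value (p # w) = letter p \<otimes> word_value w"
  by (simp_all add: word_value_def)

lemma word_value_closed:
  assumes "A \<subseteq> carrier G" "w \<in> lists (UNIV \<times> A)"
  shows "word_value w \<in> carrier G"
  using assms(2)
proof (induction w)
  case (Cons p w)
  then show ?case
    using assms(1) by (cases p) auto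
qed simp

lemma word_value_append:
  assumes "A \<subseteq> carrier G" "v \<in> lists (UNIV \<times> A)" "w \<in> lists (UNIV \<times> A)"
  shows "word_value (v @ w) = word_value v \<otimes> word_value w"
  using assms(2)
proof (induction v)
  case Nil
  then show ?case
    using word_value_closed[OF assms(1,3)] by simp
next
  case (Cons p v)
  have "letter p \<in> carrier G"
    using Cons assms(1) by (cases p) auto
  then show ?case
    using Cons word_value_closed[OF assms(1), of v] word_value_closed[OF assms(1,3)]
    by (simp add: m_assoc)
qed

lemma generate_eq_word_values:
  assumes A: "A \<subseteq> carrier G"
  shows "generate G A = word_value ` lists (UNIV \<times> A)"
proof
  show "generate G A \<subseteq> word_value ` lists (UNIV \<times> A)"
  proof
    fix g assume "g \<in> generate G A"
    then show "g \<in> word_value ` lists (UNIV \<times> A)"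
    proof induction
      case one
      have "word_value [] = \<one>"
        by simp
      then show ?case
        by (metis image_eqI lists.Nil)
    next
      case (incl h)
      then have "word_value [(True, h)] = h" "[(True, h)] \<in> lists (UNIV \<times> A)"
        using A by auto
      then show ?case
        by (metis image_eqI)
    next
      case (inv h)
      then have "word_value [(False, h)] = inv h" "[(False, h)] \<in> lists (UNIV \<times> A)"
        using A by auto
      then show ?case
        by (metis image_eqI)
    next
      case (eng h1 h2)
      then obtain v w where vw: "v \<in> lists (UNIV \<times> A)" "h1 = word_value v"
          "w \<in> lists (UNIV \<times> A)" "h2 = word_value w"
        by blast
      then have "word_value (v @ w) = h1 \<otimes> h2" "v @ w \<in> lists (UNIV \<times> A)"
        using word_value_append[OF A] by auto
      then show ?case
        by (metis image_eqI)
    qed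
  qed
  show "word_value ` lists (UNIV \<times> A) \<subseteq> generate G A"
  proof (rule image_subsetI)
    fix w :: "(bool \<times> 'a) list" assume "w \<in> lists (UNIV \<times> A)"
    then show "word_value w \<in> generate G A"
    proof (induction w)
      case Nil
      then show ?case
        by (simp add: generate.one)
    next
      case (Cons p w)
      have "letter p \<in> generate G A"
        using Cons by (cases p) (auto intro: generate.incl generate.inv)
      then show ?case
        using Cons by (simp add: generate.eng)
    qed
  qed
qed

text \<open>The words accepted by an automaton whose transitions see a letter only through its coset
  modulo \<^term>\<open>M\<close>.  Identifying the initial state with the only accepting one matches languages
  of the form: the words whose value lies in a given subgroup.\<close>

definition accepted ::
    "'a set \<Rightarrow> 'a set \<Rightarrow> (bool \<times> 'a set \<Rightarrow> nat \<Rightarrow> nat) \<Rightarrow> nat \<Rightarrow> (bool \<times> 'a) list set" where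
  "accepted M A \<delta> q =
    {w \<in> lists (UNIV \<times> A). foldr (\<lambda>p. \<delta> (fst p, snd p <# M)) w q = q}"

abbreviation coset_alphabet :: "'a set \<Rightarrow> 'a set \<Rightarrow> (bool \<times> 'a set) set" where
  "coset_alphabet M A \<equiv> UNIV \<times> (\<lambda>t. t <# M) ` A"

end

context profinite_group
begin

text \<open>The automaton has the cosets of \<^term>\<open>V\<close> as states, and a letter acts on them by left
  multiplication.  This action depends on the letter only modulo \<^term>\<open>V\<close>, hence, for letters from
  \<^term>\<open>A\<close>, only modulo \<^term>\<open>M\<close>.\<close>

lemma word_language_automaton:
  assumes A: "A \<subseteq> carrier G" and M: "M \<in> open_normal_subgroups G T"
    and V: "V \<in> open_normal_subgroups G T"
    and MV: "\<And>s t. \<lbrakk>s \<in> A; t \<in> A; inv s \<otimes> t \<in> M\<rbrakk> \<Longrightarrow> inv s \<otimes> t \<in> V"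
  shows "\<exists>n. \<exists>\<delta>\<in>coset_alphabet M A \<rightarrow>\<^sub>E {0..<n} \<rightarrow>\<^sub>E {0..<n}. \<exists>q\<in>{0..<n}.
    {w \<in> lists (UNIV \<times> A). word_value w \<in> V} = accepted M A \<delta> q"
proof -
  note V' = open_normalD(2)[OF V] and M' = open_normalD(2)[OF M]
  let ?C = "(\<lambda>x. x <# V) ` carrier G"
  define n where "n = card ?C"
  obtain h where h: "bij_betw h ?C {0..<n}"
    unfolding n_def using ex_bij_betw_finite_nat[OF finite_cosets[OF V]] by blast
  define st where "st x = h (x <# V)" for x
  have st_less: "st x \<in> {0..<n}" if "x \<in> carrier G" for x
    using h that unfolding st_def bij_betw_def by blast
  have st_eq: "st x = st y \<longleftrightarrow> inv x \<otimes> y \<in> V" if "x \<in> carrier G" "y \<in> carrier G" for x y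
  proof -
    have "st x = st y \<longleftrightarrow> x <# V = y <# V"
      using h that unfolding st_def bij_betw_def by (intro inj_on_eq_iff[of h ?C]) auto
    then show ?thesis
      using l_coset_eq_iff[OF that V'] by simp
  qed
  define rp where "rp i = (SOME x. x \<in> carrier G \<and> st x = i)" for i
  have rp: "rp (st x) \<in> carrier G" "st (rp (st x)) = st x" if "x \<in> carrier G" for x
    using someI[of "\<lambda>y. y \<in> carrier G \<and> st y = st x" x] that by (auto simp: rp_def)
  have st_surj: "\<exists>x\<in>carrier G. i = st x" if "i \<in> {0..<n}" for i
    using h that unfolding st_def bij_betw_def by blast
  \<comment> \<open>The representative of a letter is taken in \<^term>\<open>A\<close>, where congruence modulo \<^term>\<open>M\<close> implies
    congruence modulo \<^term>\<open>V\<close>.\<close>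
  define tp where "tp c = (SOME t. t \<in> A \<and> t <# M = c)" for c
  have tp: "tp (t <# M) \<in> A" "tp (t <# M) <# M = t <# M" if "t \<in> A" for t
    using someI[of "\<lambda>s. s \<in> A \<and> s <# M = t <# M" t] that by (auto simp: tp_def)
  have letter_G: "letter (b, t) \<in> carrier G" if "t \<in> A" for b t
    using that A by auto
  define \<delta> where "\<delta> = restrict (\<lambda>(b, c). restrict (\<lambda>i. st (letter (b, tp c) \<otimes> rp i)) {0..<n})
    (coset_alphabet M A)"
  have "\<delta> \<in> coset_alphabet M A \<rightarrow>\<^sub>E {0..<n} \<rightarrow>\<^sub>E {0..<n}"
  proof (rule PiE_I)
    fix p assume p: "p \<in> coset_alphabet M A"
    obtain b t where bt: "p = (b, t <# M)" "t \<in> A"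
      using p by auto
    have "st (letter (b, tp (t <# M)) \<otimes> rp i) \<in> {0..<n}" if "i \<in> {0..<n}" for i
      using st_surj[OF that] rp(1) letter_G[OF tp(1)[OF bt(2)]] by (intro st_less m_closed) auto
    then show "\<delta> p \<in> {0..<n} \<rightarrow>\<^sub>E {0..<n}"
      using p by (simp add: \<delta>_def bt(1))
  qed (simp add: \<delta>_def)
  moreover have "st \<one> \<in> {0..<n}"
    by (intro st_less one_closed)
  moreover have "{w \<in> lists (UNIV \<times> A). word_value w \<in> V} = accepted M A \<delta> (st \<one>)"
  proof -
    have step: "\<delta> (b, t <# M) (st x) = st (letter (b, t) \<otimes> x)" if t: "t \<in> A" and x: "x \<in> carrier G" for b t x
    proof -
      let ?t = "tp (t <# M)" and ?x = "rp (st x)"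
      let ?l = "letter (b, t)" and ?k = "letter (b, ?t)"
      have tG: "t \<in> carrier G" "?t \<in> carrier G"
        using t tp(1)[OF t] A by auto
      have xG: "?x \<in> carrier G" "inv ?x \<otimes> x \<in> V"
        using rp[OF x] st_eq[OF rp(1)[OF x] x] by auto
      have "inv ?t \<otimes> t \<in> M"
        using tp(2)[OF t] l_coset_eq_iff[OF tG(2,1) M'] by simp
      then have tV: "inv ?t \<otimes> t \<in> V"
        using MV[OF tp(1)[OF t] t] by simp
      have kl: "inv ?k \<otimes> ?l \<in> V"
      proof (cases b)
        case False
        have "t \<otimes> inv (inv ?t \<otimes> t) \<otimes> inv t \<in> V"
          by (rule open_normal_conj(1)[OF V subgroup.m_inv_closed[OF V' tV] tG(1)])
        also have "t \<otimes> inv (inv ?t \<otimes> t) \<otimes> inv t = ?t \<otimes> inv t"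
          using tG by (simp add: inv_mult_group m_assoc mult_inv_cancel)
        finally show ?thesis
          using False tG by simp
      qed (use tV in simp)
      have kG: "?k \<in> carrier G" "?l \<in> carrier G"
        using letter_G[OF tp(1)[OF t]] letter_G[OF t] .
      have "inv (?k \<otimes> ?x) \<otimes> (?l \<otimes> x) = (inv ?x \<otimes> (inv ?k \<otimes> ?l) \<otimes> ?x) \<otimes> (inv ?x \<otimes> x)"
        using kG x xG(1) by (simp del: letter.simps add: inv_mult_group m_assoc mult_inv_cancel)
      also have "\<dots> \<in> V"
        by (rule subgroup.m_closed[OF V' open_normal_conj(2)[OF V kl xG(1)] xG(2)])
      finally have "st (?k \<otimes> ?x) = st (?l \<otimes> x)"
        using kG x xG(1) st_eq[of "?k \<otimes> ?x" "?l \<otimes> x"] by (simp del: letter.simps)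
      then show ?thesis
        using t st_less[OF x] by (simp del: letter.simps add: \<delta>_def)
    qed
    have run: "foldr (\<lambda>p. \<delta> (fst p, snd p <# M)) w (st \<one>) = st (word_value w)"
      if "w \<in> lists (UNIV \<times> A)" for w
      using that
    proof (induction w)
      case (Cons p w)
      obtain b t where "p = (b, t)" "t \<in> A"
        using Cons by (cases p) auto
      then show ?case
        using Cons step[of t "word_value w" b] word_value_closed[OF A, of w]
        by (simp del: letter.simps)
    qed simp
    have "word_value w \<in> V \<longleftrightarrow> foldr (\<lambda>p. \<delta> (fst p, snd p <# M)) w (st \<one>) = st \<one>"
      if "w \<in> lists (UNIV \<times> A)" for w
      using st_eq[of \<one> "word_value w"] word_value_closed[OF A that] run[OF that] by auto
    then show ?thesis
      unfolding accepted_def by (intro Collect_cong conj_cong refl)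
  qed
  ultimately show ?thesis
    by blast
qed

text \<open>For each of the countably many alphabets and each number of states there are only finitely many
  automata.\<close>

lemma countable_word_languages:
  assumes A: "A \<subseteq> carrier G" and W: "\<And>n::nat. W n \<in> open_normal_subgroups G T"
    and unif: "\<And>V. V \<in> open_normal_subgroups G T \<Longrightarrow>
      \<exists>k. \<forall>s\<in>A. \<forall>t\<in>A. inv s \<otimes> t \<in> W k \<longrightarrow> inv s \<otimes> t \<in> V"
  shows "countable ((\<lambda>V. {w \<in> lists (UNIV \<times> A). word_value w \<in> V}) ` open_normal_subgroups G T)"
proof (rule countable_subset)
  let ?D = "\<lambda>k n. (coset_alphabet (W k) A \<rightarrow>\<^sub>E {0..<n} \<rightarrow>\<^sub>E {0..<n}) \<times> {0..<n::nat}"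
  let ?\<L> = "\<Union>k. \<Union>n. (\<lambda>(\<delta>, q). accepted (W k) A \<delta> q) ` ?D k n"
  show "(\<lambda>V. {w \<in> lists (UNIV \<times> A). word_value w \<in> V}) ` open_normal_subgroups G T \<subseteq> ?\<L>"
  proof clarify
    fix V assume V: "V \<in> open_normal_subgroups G T"
    then obtain k where k: "\<And>s t. \<lbrakk>s \<in> A; t \<in> A; inv s \<otimes> t \<in> W k\<rbrakk> \<Longrightarrow> inv s \<otimes> t \<in> V"
      using unif by blast
    obtain n \<delta> q where "(\<delta>, q) \<in> ?D k n"
        "{w \<in> lists (UNIV \<times> A). word_value w \<in> V} = accepted (W k) A \<delta> q"
      using word_language_automaton[OF A W[of k] V k] by blast
    then have "{w \<in> lists (UNIV \<times> A). word_value w \<in> V} \<in>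
        (\<lambda>(\<delta>, q). accepted (W k) A \<delta> q) ` ?D k n"
      by (intro image_eqI[of _ _ "(\<delta>, q)"]) (simp_all only: split_conv)
    then show "{w \<in> lists (UNIV \<times> A). word_value w \<in> V} \<in> ?\<L>"
      by (intro UN_I[OF UNIV_I])
  qed
  have "finite (?D k n)" for k n
  proof -
    have "finite ((\<lambda>t. t <# W k) ` A)"
      using finite_subset[OF image_mono[OF A] finite_cosets[OF W[of k]]] .
    then have "finite (coset_alphabet (W k) A)"
      by simp
    then have "finite (coset_alphabet (W k) A \<rightarrow>\<^sub>E {0..<n} \<rightarrow>\<^sub>E {0..<n})"
      by (rule finite_PiE) (intro finite_PiE finite_atLeastLessThan)
    then show ?thesis
      by (rule finite_cartesian_product) (rule finite_atLeastLessThan)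
  qed
  then show "countable ?\<L>"
    by (intro countable_UN countableI_type countable_finite finite_imageI)
qed

text \<open>If \<^term>\<open>H\<close> contains \<^term>\<open>N\<close>, the closed subgroup generated by the part in \<^term>\<open>H\<close> of a
  transversal of \<^term>\<open>N\<close> has the same image as \<^term>\<open>H\<close> modulo \<^term>\<open>N\<close>.  It is a proper
  subgroup: otherwise the open normal subgroups would have only countably many traces on
  \<^term>\<open>H\<close>, because a trace is determined by a language and these languages are countable in
  number.\<close>

lemma exists_proper_supplement:
  assumes N: "countably_cut N" and triv: "\<not> countably_cut {\<one>}"
    and H: "H \<in> closed_subgroups G T" and NH: "N \<subseteq> H"
  obtains K where "K \<in> closed_subgroups G T" "K \<noteq> H" "K <#> N = H <#> N"
proof -
  let ?O = "open_normal_subgroups G T"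
  note HG = closed_subgroupsD(3)[OF H] and H' = closed_subgroupsD(1)[OF H]
  note N' = countably_cutD[OF N]
  obtain B where B: "closedin T B" "\<And>g. g \<in> carrier G \<Longrightarrow> \<exists>n\<in>N. g \<otimes> n \<in> B"
      "\<And>t r. \<lbrakk>t \<in> B; r \<in> N; t \<otimes> r \<in> B\<rbrakk> \<Longrightarrow> r = \<one>"
    using closed_transversal[OF N'(2,3)] by metis
  define A where "A = B \<inter> H"
  have AG: "A \<subseteq> carrier G"
    using HG by (auto simp: A_def)
  define \<Gamma> where "\<Gamma> = generate G A"
  have \<Gamma>: "subgroup \<Gamma> G" "\<Gamma> \<subseteq> H" "A \<subseteq> \<Gamma>"
    unfolding \<Gamma>_def using generate_is_subgroup[OF AG] generate_subgroup_incl[of A H] H'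
    by (auto simp: A_def intro: generate.incl)
  note \<Gamma>G = subgroup.subset[OF \<Gamma>(1)]
  define K where "K = (\<Inter>V\<in>?O. \<Gamma> <#> V)"
  have O_ne: "?O \<noteq> {}"
    using carrier_open_normal by blast
  have "subgroup (\<Gamma> <#> V) G" if V: "V \<in> ?O" for V
    unfolding commut_normal[OF \<Gamma>(1) open_normalD(1)[OF V]]
    using mult_norm_subgroup[OF open_normalD(1)[OF V] \<Gamma>(1)] .
  then have K: "K \<in> closed_subgroups G T"
    using O_ne clopen_set_mult(2)[OF _ \<Gamma>G] unfolding K_def closed_subgroups_def
    by (auto intro!: subgroups_Inter closedin_Inter)
  have "\<Gamma> \<subseteq> K"
    unfolding K_def using subset_set_mult[OF \<Gamma>G open_normalD(2)] by blast
  have "K \<subseteq> (\<Inter>V\<in>?O. H <#> V)"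
    unfolding K_def using set_mult_mono_left[OF \<Gamma>(2)] by blast
  then have KH: "K \<subseteq> H"
    using closed_eq_Inter[OF closed_subgroupsD(2)[OF H]] by simp
  have "H \<subseteq> K <#> N"
  proof
    fix h assume h: "h \<in> H"
    then obtain n where n: "n \<in> N" "h \<otimes> n \<in> B"
      using B(2) HG by blast
    then have "h \<otimes> n \<in> K"
      using subgroup.m_closed[OF H' h] NH \<Gamma>(3) \<open>\<Gamma> \<subseteq> K\<close> by (auto simp: A_def)
    then have "h \<otimes> n \<otimes> inv n \<in> K <#> N"
      using subgroup.m_inv_closed[OF N'(2) n(1)] by (rule set_mult_memI)
    then show "h \<in> K <#> N"
      using h n(1) HG NH by (simp add: m_assoc subsetD)
  qed
  moreover have "H <#> N = H"
    using set_mult_absorb(2)[OF N'(2) H' NH] .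
  moreover have "K <#> N \<subseteq> H <#> N"
    by (rule set_mult_mono_left[OF KH])
  ultimately have KN: "K <#> N = H <#> N"
    by blast
  have "K \<noteq> H"
  proof
    assume KH: "K = H"
    obtain W where W: "\<And>n::nat. W n \<in> ?O" "decseq W" "N = (\<Inter>n. W n)"
      using countably_cut_sequence[OF N] by metis
    have "\<exists>k. \<forall>s\<in>A. \<forall>t\<in>A. inv s \<otimes> t \<in> W k \<longrightarrow> inv s \<otimes> t \<in> V" if V: "V \<in> ?O" for V
    proof -
      have "\<exists>k. \<forall>s\<in>B. \<forall>t\<in>B. inv s \<otimes> t \<in> W k \<longrightarrow> inv s \<otimes> t \<in> V"
        by (rule transversal_uniform[OF B(1) _ W V]) (rule B(3))
      then show ?thesis
        by (auto simp: A_def)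
    qed
    note lang = countable_word_languages[OF AG W(1) this]
    define lang where "lang V = {w \<in> lists (UNIV \<times> A). word_value w \<in> V}" for V
    \<comment> \<open>Elements of \<^term>\<open>H\<close> agree modulo \<open>V \<inter> V'\<close> with values of words.\<close>
    have trace: "V \<inter> H \<subseteq> V' \<inter> H" if V: "V \<in> ?O" "V' \<in> ?O" "lang V = lang V'" for V V'
    proof
      fix h assume h: "h \<in> V \<inter> H"
      have VV: "V \<inter> V' \<in> ?O"
        using open_normal_Int[OF V(1,2)] .
      have "h \<in> \<Gamma> <#> (V \<inter> V')"
        using h VV KH by (auto simp: K_def)
      then obtain g v where g: "g \<in> \<Gamma>" "v \<in> V \<inter> V'" "h = g \<otimes> v"
        by (auto simp: set_mult_def)
      have G: "g \<in> carrier G" "v \<in> carrier G"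
        using g \<Gamma>G open_normalD(4)[OF VV] by auto
      have "g = h \<otimes> inv v"
        using g(3) G by (simp add: m_assoc)
      also have "\<dots> \<in> V"
        using h g(2) open_normalD(2)[OF V(1)]
        by (intro subgroup.m_closed[of V] subgroup.m_inv_closed[of V]) auto
      finally have "g \<in> V" .
      obtain w where w: "w \<in> lists (UNIV \<times> A)" "g = word_value w"
        using g(1) generate_eq_word_values[OF AG] by (auto simp: \<Gamma>_def)
      then have "w \<in> lang V"
        using \<open>g \<in> V\<close> by (simp add: lang_def)
      then have "w \<in> lang V'"
        using V(3) by simp
      then have "g \<in> V'"
        using w(2) by (simp add: lang_def)
      then have "h \<in> V'"
        unfolding g(3) using g(2) by (intro subgroup.m_closed[OF open_normalD(2)[OF V(2)]]) auto
      with h show "h \<in> V' \<inter> H"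
        by blast
    qed
    have "countable (lang ` ?O)"
      using lang by (simp add: lang_def[abs_def])
    then obtain \<V> where \<V>: "countable \<V>" "\<V> \<subseteq> ?O" "lang ` \<V> = lang ` ?O"
      using countable_image_eq_inj[of lang ?O] countable_subset_image by (metis subset_refl)
    \<comment> \<open>Inserting \<^term>\<open>carrier G\<close> keeps the family nonempty.\<close>
    have "x = \<one>" if x: "x \<in> \<Inter>(insert (carrier G) \<V>) \<inter> N" for x
    proof -
      have "x \<in> V" if V: "V \<in> ?O" for V
      proof -
        have "lang V \<in> lang ` \<V>"
          unfolding \<V>(3) using V by (rule imageI)
        then obtain V' where V': "V' \<in> \<V>" "lang V = lang V'"
          by (rule imageE)
        have "x \<in> V' \<inter> H"
          using x V'(1) NH by auto
        then show ?thesis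
          using trace[OF subsetD[OF \<V>(2) V'(1)] V V'(2)[symmetric]] by blast
      qed
      then show ?thesis
        using Inter_open_normal by blast
    qed
    moreover have "\<one> \<in> \<Inter>(insert (carrier G) \<V>) \<inter> N"
      using \<V>(2) open_normalD(5) subgroup.one_closed[OF N'(2)] by auto
    ultimately have "\<Inter>(insert (carrier G) \<V> \<union> {N}) = {\<one>}"
      by auto
    moreover have "countably_cut (\<Inter>(insert (carrier G) \<V> \<union> {N}))"
      using \<V>(1,2) N open_normal_countably_cut carrier_open_normal
      by (intro countably_cut_Inter) auto
    ultimately show False
      using triv by simp
  qed
  with K KN that show thesis
    by blast
qed

text \<open>If \<^term>\<open>N\<close> is not contained in \<^term>\<open>H\<close>, then \<^term>\<open>H <#> N\<close> is a different subgroup with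
  the same image; otherwise there is a proper supplement.\<close>

lemma eq_mod_not_isolated:
  assumes N: "countably_cut N" and triv: "\<not> countably_cut {\<one>}" and H: "H \<in> closed_subgroups G T"
  obtains K where "(H, K) \<in> eq_mod N" "K \<noteq> H"
proof (cases "N \<subseteq> H")
  case True
  obtain K where "K \<in> closed_subgroups G T" "K \<noteq> H" "K <#> N = H <#> N"
    using exists_proper_supplement[OF N triv H True] .
  then show thesis
    using H by (intro that[of K]) (simp_all add: eq_mod_def)
next
  case False
  note N' = countably_cutD[OF N] and HG = closed_subgroupsD(3)[OF H]
  have "H <#> N \<in> closed_subgroups G T"
    by (rule closed_subgroup_mult[OF H N'(1,3)])
  moreover have "H <#> N <#> N = H <#> N"
    by (rule set_mult_absorb_right[OF HG N'(2,2) order_refl])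
  moreover have "N \<subseteq> H <#> N"
  proof
    fix n assume n: "n \<in> N"
    then have "\<one> \<otimes> n \<in> H <#> N"
      using closed_subgroupsD(4)[OF H] by (intro set_mult_memI)
    then show "n \<in> H <#> N"
      using n subgroup.mem_carrier[OF N'(2) n] by simp
  qed
  ultimately show thesis
    using False H that[of "H <#> N"] by (auto simp: eq_mod_def)
qed

text \<open>A clopen set is saturated modulo some open normal \<open>M\<close>, so a second point of the class within
  the set is found by moving modulo \<open>N \<inter> M\<close>, which is again the kernel of a metrizable quotient.\<close>

lemma perfect_equiv_eq_mod:
  assumes N: "countably_cut N" and triv: "\<not> countably_cut {\<one>}"
  shows "perfect_equiv (subgroup_space G T) (eq_mod N)"
  unfolding perfect_equiv_def
proof (intro allI impI)
  fix B H assume B: "clopenin (subgroup_space G T) B" and H: "H \<in> B"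
  obtain M where M: "M \<in> open_normal_subgroups G T" "eq_mod M `` B \<subseteq> B"
    using clopen_imp_saturated B unfolding clopenin_def by metis
  have "countably_cut (\<Inter>{N, M})"
    using N open_normal_countably_cut[OF M(1)] by (intro countably_cut_Inter) auto
  then have P: "countably_cut (N \<inter> M)"
    by simp
  have "H \<in> closed_subgroups G T"
    using H clopenin_subset[OF B] topspace_subgroup_space by auto
  then obtain K where K: "(H, K) \<in> eq_mod (N \<inter> M)" "K \<noteq> H"
    using eq_mod_not_isolated[OF P triv] by metis
  have "eq_mod (N \<inter> M) \<subseteq> eq_mod N" "eq_mod (N \<inter> M) \<subseteq> eq_mod M"
    by (rule eq_mod_mono[OF countably_cutD(2)[OF P] countably_cutD(2)[OF N] Int_lower1]
        eq_mod_mono[OF countably_cutD(2)[OF P] open_normalD(2)[OF M(1)] Int_lower2])+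
  then have "(H, K) \<in> eq_mod N" "(H, K) \<in> eq_mod M"
    using K(1) by blast+
  moreover have "K \<in> B"
    by (rule subsetD[OF M(2) ImageI[OF \<open>(H, K) \<in> eq_mod M\<close> H]])
  ultimately show "\<exists>K\<in>B. K \<noteq> H \<and> (H, K) \<in> eq_mod N"
    using K(2) by blast
qed

end

section \<open>Transfinite construction of the independent family\<close>

sublocale profinite_group \<subseteq> subgroups: boolean_space "subgroup_space G T"
proof
  show "compact_space (subgroup_space G T)"
    by (rule compact_subgroup_space)
  fix H K assume HK: "H \<in> topspace (subgroup_space G T)" "K \<in> topspace (subgroup_space G T)" "H \<noteq> K"
  then have cs: "H \<in> closed_subgroups G T" "K \<in> closed_subgroups G T"
    by (simp_all add: topspace_subgroup_space)
  then obtain V where V: "V \<in> open_normal_subgroups G T" "H <#> V \<noteq> K <#> V"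
    using closed_subgroup_eqI[OF cs] HK(3) by metis
  then have "clopenin (subgroup_space G T) (subgroup_nbhd G T H V)"
      "H \<in> subgroup_nbhd G T H V" "K \<notin> subgroup_nbhd G T H V"
    using subgroup_nbhd_clopen[OF V(1) cs(1)] cs
    by (auto simp: clopenin_def subgroup_nbhd_def)
  then show "\<exists>b. clopenin (subgroup_space G T) b \<and> H \<in> b \<and> K \<notin> b"
    by blast
qed

context profinite_group
begin

abbreviation subgroup_pairs :: "('a set \<times> 'a set) set" where
  "subgroup_pairs \<equiv> closed_subgroups G T \<times> closed_subgroups G T"

lemma open_equiv_eq_mod:
  assumes "N \<lhd> G" "closedin T N"
  shows "open_equiv (subgroup_space G T) (eq_mod N)"
  unfolding open_equiv_def clopenin_def topspace_subgroup_space
  using equiv_eq_mod eq_mod_open[OF assms] by blast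

lemma trivial_closed_subgroup: "{\<one>} \<in> closed_subgroups G T"
  using Hausdorff triv_subgroup one_closed
  by (auto simp: closed_subgroups_def closedin_Hausdorff_sing_eq topspace_eq)

text \<open>The subgroup \<^term>\<open>N\<close> is recovered from \<^term>\<open>eq_mod N\<close> as the largest subgroup that is identified
  with the trivial one.\<close>

lemma eq_mod_subset_imp_subset:
  assumes N: "subgroup N G" "closedin T N" and M: "subgroup M G" and NM: "eq_mod N \<subseteq> eq_mod M"
  shows "N \<subseteq> M"
proof -
  have "({\<one>}, N) \<in> eq_mod N"
    using trivial_closed_subgroup N set_mult_absorb(1)[OF triv_subgroup N(1)]
      set_mult_absorb(1)[OF N(1) N(1) order_refl] subgroup.one_closed[OF N(1)]
    by (simp add: eq_mod_def closed_subgroups_def)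
  then have "({\<one>}, N) \<in> eq_mod M"
    using NM by (rule subsetD[rotated])
  then have "N <#> M = {\<one>} <#> M"
    by (simp add: eq_mod_def)
  also have "\<dots> = M"
    using set_mult_absorb(1)[OF triv_subgroup M] subgroup.one_closed[OF M] by simp
  finally show ?thesis
    using subset_set_mult[OF subgroup.subset[OF N(1)] M] by simp
qed

text \<open>A countable stage of the construction: the family identifies the space of closed subgroups
  of the metrizable quotient by some \<open>N\<close> with a Cantor cube.\<close>

definition cube_stage :: "'a set set set \<Rightarrow> bool" where
  "cube_stage F \<longleftrightarrow> countable F \<and> (\<forall>c\<in>F. clopenin (subgroup_space G T) c) \<and>
    subgroups.independent F \<and> (\<exists>N. countably_cut N \<and> eq_mod N = subgroup_pairs \<inter> agree_on F)"

lemma cube_stage_empty: "cube_stage {}"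
proof -
  have "H <#> carrier G = carrier G" if "H \<in> closed_subgroups G T" for H
    using set_mult_absorb(1)[OF closed_subgroupsD(1)[OF that] subgroup_self closed_subgroupsD(3)[OF that]] .
  then have "eq_mod (carrier G) = subgroup_pairs \<inter> agree_on {}"
    by (auto simp: eq_mod_def agree_on_def)
  moreover have "subgroups.independent {}"
    using trivial_closed_subgroup by (auto simp: subgroups.independent_def topspace_subgroup_space)
  ultimately show ?thesis
    using open_normal_countably_cut[OF carrier_open_normal] by (auto simp: cube_stage_def)
qed

text \<open>At limits the subgroups \<open>N\<close> of the stages, which are determined by the stages, form a chain,
  and reduction modulo an intersection of a chain is the conjunction of the reductions.  The union
  has to be countable for the intersection to have a metrizable quotient.\<close>

lemma cube_stage_Union:
  assumes chain: "subset.chain UNIV \<K>" and ne: "\<K> \<noteq> {}" and count: "countable \<K>"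
    and \<K>: "\<And>F. F \<in> \<K> \<Longrightarrow> cube_stage F"
  shows "cube_stage (\<Union>\<K>)"
proof -
  obtain n where n: "\<And>F. F \<in> \<K> \<Longrightarrow> countably_cut (n F)"
      "\<And>F. F \<in> \<K> \<Longrightarrow> eq_mod (n F) = subgroup_pairs \<inter> agree_on F"
    using \<K> unfolding cube_stage_def by metis
  have anti: "n F' \<subseteq> n F" if F: "F \<in> \<K>" "F' \<in> \<K>" "F \<subseteq> F'" for F F'
  proof (rule eq_mod_subset_imp_subset)
    show "eq_mod (n F') \<subseteq> eq_mod (n F)"
      using agree_on_mono[OF F(3)] unfolding n(2)[OF F(1)] n(2)[OF F(2)] by blast
  qed (use countably_cutD(2,3) n(1) F in auto)
  have "down_directed (n ` \<K>)"
  proof -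
    have "\<exists>C\<in>\<K>. n C \<subseteq> n A \<inter> n B" if AB: "A \<in> \<K>" "B \<in> \<K>" for A B
    proof -
      have "A \<subseteq> B \<or> B \<subseteq> A"
        using chain AB unfolding subset.chain_def by blast
      then show ?thesis
        using anti[of A B] anti[of B A] AB by (metis Int_greatest order_refl)
    qed
    then show ?thesis
      using ne by (auto simp: down_directed_def)
  qed
  then have "eq_mod (\<Inter>(n ` \<K>)) = (\<Inter>N\<in>n ` \<K>. eq_mod N)"
    using countably_cutD(2,3) n(1) by (intro eq_mod_Inter) auto
  also have "\<dots> = (\<Inter>F\<in>\<K>. subgroup_pairs \<inter> agree_on F)"
    using n(2) by simp
  also have "\<dots> = subgroup_pairs \<inter> agree_on (\<Union>\<K>)"
    using ne by (auto simp: agree_on_def)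
  finally have "eq_mod (\<Inter>(n ` \<K>)) = subgroup_pairs \<inter> agree_on (\<Union>\<K>)" .
  moreover have "countably_cut (\<Inter>(n ` \<K>))"
    using count ne n(1) by (intro countably_cut_Inter) auto
  moreover have "subgroups.independent (\<Union>\<K>)"
    using \<K> by (intro subgroups.independent_Union_chain chain ne) (auto simp: cube_stage_def)
  moreover have "countable (\<Union>F\<in>\<K>. F)"
    by (rule countable_UN[OF count]) (use \<K> in \<open>simp add: cube_stage_def\<close>)
  then have "countable (\<Union>\<K>)"
    by simp
  moreover have "\<forall>c\<in>\<Union>\<K>. clopenin (subgroup_space G T) c"
    using \<K> by (auto simp: cube_stage_def)
  ultimately show ?thesis
    unfolding cube_stage_def by blast
qed

lemma saturated_imp_agree:
  assumes "\<And>c. c \<in> \<C> \<Longrightarrow> eq_mod V `` c \<subseteq> c"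
  shows "eq_mod V \<subseteq> agree_on \<C>"
proof clarify
  fix H K assume HK: "(H, K) \<in> eq_mod V"
  then have KH: "(K, H) \<in> eq_mod V"
    by (simp add: eq_mod_def)
  have "H \<in> c \<longleftrightarrow> K \<in> c" if "c \<in> \<C>" for c
    using assms[OF that] HK KH by blast
  then show "(H, K) \<in> agree_on \<C>"
    by (simp add: agree_on_def)
qed

lemma finite_common_saturation:
  assumes "finite \<C>" "\<And>c. c \<in> \<C> \<Longrightarrow> clopenin (subgroup_space G T) c"
    and V: "V \<in> open_normal_subgroups G T"
  obtains V' where "V' \<in> open_normal_subgroups G T" "V' \<subseteq> V" "eq_mod V' \<subseteq> agree_on \<C>"
proof -
  have "\<exists>v\<in>open_normal_subgroups G T. eq_mod v `` c \<subseteq> c" if "c \<in> \<C>" for c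
    using clopen_imp_saturated[of c] assms(2)[OF that] unfolding clopenin_def by metis
  then obtain v where v: "\<And>c. c \<in> \<C> \<Longrightarrow> v c \<in> open_normal_subgroups G T"
      "\<And>c. c \<in> \<C> \<Longrightarrow> eq_mod (v c) `` c \<subseteq> c"
    by metis
  define V' where "V' = \<Inter>(insert V (v ` \<C>))"
  have V': "V' \<in> open_normal_subgroups G T"
    unfolding V'_def using assms(1) V v(1) by (intro open_normal_finite_Inter) auto
  have "eq_mod V' `` c \<subseteq> c" if c: "c \<in> \<C>" for c
  proof -
    have "V' \<subseteq> v c"
      using c by (auto simp: V'_def)
    then have "eq_mod V' \<subseteq> eq_mod (v c)"
      by (rule eq_mod_mono[OF open_normalD(2)[OF V'] open_normalD(2)[OF v(1)[OF c]]])
    then have "eq_mod V' `` c \<subseteq> eq_mod (v c) `` c"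
      by (rule Image_mono) (rule order_refl)
    also have "\<dots> \<subseteq> c"
      by (rule v(2)[OF c])
    finally show ?thesis .
  qed
  then have "eq_mod V' \<subseteq> agree_on \<C>"
    by (rule saturated_imp_agree)
  moreover have "V' \<subseteq> V"
    by (auto simp: V'_def)
  ultimately show thesis
    using that V' by blast
qed

text \<open>There are only finitely many classes modulo \<^term>\<open>V\<close>, and each of them is clopen, so finitely
  many further independent sets decide to which of them a subgroup belongs.\<close>

lemma refine_to_open_normal:
  assumes N: "countably_cut N" and triv: "\<not> countably_cut {\<one>}"
    and \<C>: "finite \<C>" "\<And>c. c \<in> \<C> \<Longrightarrow> clopenin (subgroup_space G T) c"
      "subgroups.independent_over (eq_mod N) \<C>"
    and V: "V \<in> open_normal_subgroups G T"
  obtains \<C>' where "\<C> \<subseteq> \<C>'" "finite \<C>'" "\<forall>c\<in>\<C>'. clopenin (subgroup_space G T) c"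
    "subgroups.independent_over (eq_mod N) \<C>'" "eq_mod N \<inter> agree_on \<C>' \<subseteq> eq_mod V"
proof -
  let ?b = "\<lambda>A. {K \<in> closed_subgroups G T. K <#> V = A}"
  let ?\<A> = "{A. A \<subseteq> carrier G \<and> A <#> V = A}"
  have clo: "clopenin (subgroup_space G T) (?b A)" for A
    unfolding clopenin_def using saturated_clopen[OF V, of "?b A"] by (auto simp: eq_mod_def)
  have "\<exists>\<C>'. \<C> \<subseteq> \<C>' \<and> finite \<C>' \<and> (\<forall>c\<in>\<C>'. clopenin (subgroup_space G T) c) \<and>
      subgroups.independent_over (eq_mod N) \<C>' \<and> eq_mod N \<inter> agree_on \<C>' \<subseteq> agree_on (?b ` ?\<A>)"
  proof (rule subgroups.extend_independent_over[OF _ _ \<C>])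
    show "open_equiv (subgroup_space G T) (eq_mod N)"
      using countably_cutD[OF N] by (intro open_equiv_eq_mod)
    show "perfect_equiv (subgroup_space G T) (eq_mod N)"
      by (rule perfect_equiv_eq_mod[OF N triv])
    show "finite (?b ` ?\<A>)"
      by (rule finite_imageI[OF finite_coset_unions[OF V]])
  qed (use clo in auto)
  then obtain \<C>' where C': "\<C> \<subseteq> \<C>'" "finite \<C>'" "\<forall>c\<in>\<C>'. clopenin (subgroup_space G T) c"
      "subgroups.independent_over (eq_mod N) \<C>'" "eq_mod N \<inter> agree_on \<C>' \<subseteq> agree_on (?b ` ?\<A>)"
    by blast
  have "eq_mod N \<inter> agree_on \<C>' \<subseteq> eq_mod V"
  proof clarify
    fix H K assume HK: "(H, K) \<in> eq_mod N" "(H, K) \<in> agree_on \<C>'"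
    then have cs: "H \<in> closed_subgroups G T" "K \<in> closed_subgroups G T"
      by (auto simp: eq_mod_def)
    have agree: "(H, K) \<in> agree_on (?b ` ?\<A>)"
      by (rule subsetD[OF C'(5)]) (simp add: HK)
    have "H <#> V \<in> ?\<A>"
      using set_mult_absorb_right[OF closed_subgroupsD(3)[OF cs(1)] open_normalD(2)[OF V] open_normalD(2)[OF V] order_refl]
        closed_subgroupsD(3)[OF closed_subgroup_mult[OF cs(1) open_normalD(1)[OF V] open_normal_closed[OF V]]]
      by simp
    then have "H \<in> ?b (H <#> V) \<longleftrightarrow> K \<in> ?b (H <#> V)"
      by (intro agree_onD[OF agree] imageI)
    then show "(H, K) \<in> eq_mod V"
      using cs by (simp add: eq_mod_def)
  qed
  with C' show thesis
    by (intro that[of \<C>']) auto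
qed

text \<open>Capturing the classes modulo one open normal subgroup introduces new clopen sets, which are
  only saturated for a smaller open normal subgroup; iterating \<open>\<omega>\<close> times closes off.  The terms
  \<open>V n\<close> are also kept inside those of a sequence with intersection \<open>N\<close>, since equality modulo \<open>N\<close> and
  modulo \<open>V n\<close> does not imply equality modulo \<open>N \<inter> V n\<close>, while equality modulo all terms of a
  decreasing sequence is equality modulo its intersection.\<close>

lemma cube_stage_extend:
  assumes F: "cube_stage F" and triv: "\<not> countably_cut {\<one>}" and U: "U \<in> open_normal_subgroups G T"
  obtains F' where "cube_stage F'" "F \<subseteq> F'" "subgroup_pairs \<inter> agree_on F' \<subseteq> eq_mod U"
proof -
  let ?O = "open_normal_subgroups G T" and ?S = "subgroup_space G T"
  obtain N where N: "countably_cut N" "eq_mod N = subgroup_pairs \<inter> agree_on F"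
    using F by (auto simp: cube_stage_def)
  obtain W where W: "\<And>n::nat. W n \<in> ?O" "decseq W" "N = (\<Inter>n. W n)"
    using countably_cut_sequence[OF N(1)] by metis
  \<comment> \<open>A state is a finite set of clopen sets with an open normal subgroup modulo which they are
    saturated.  The first subgroup is \<^term>\<open>U\<close>, so that the result refines equality modulo \<^term>\<open>U\<close>.\<close>
  let ?P = "\<lambda>(n::nat) (\<C>, V). finite \<C> \<and> (\<forall>c\<in>\<C>. clopenin ?S c) \<and>
    subgroups.independent_over (eq_mod N) \<C> \<and> V \<in> ?O \<and> eq_mod V \<subseteq> agree_on \<C> \<and>
    (n = 0 \<longrightarrow> V = U)"
  let ?Q = "\<lambda>n (\<C>, V) (\<C>', V'). \<C> \<subseteq> \<C>' \<and> V' \<subseteq> V \<inter> W n \<and> eq_mod N \<inter> agree_on \<C>' \<subseteq> eq_mod V"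
  have "\<exists>s. \<forall>n. ?P n (s n) \<and> ?Q n (s n) (s (Suc n))"
  proof (rule dependent_nat_choice)
    have "subgroups.independent_over (eq_mod N) {}"
      using equiv_eq_mod[of N] topspace_subgroup_space
      by (auto simp: subgroups.independent_over_def equiv_def refl_on_def)
    then have "?P 0 ({}, U)"
      using U by (simp add: agree_on_def)
    then show "\<exists>x. ?P 0 x"
      by blast
  next
    fix x n assume x: "?P n x"
    obtain \<C> V where [simp]: "x = (\<C>, V)"
      by (cases x)
    have P: "finite \<C>" "\<And>c. c \<in> \<C> \<Longrightarrow> clopenin ?S c" "subgroups.independent_over (eq_mod N) \<C>" "V \<in> ?O"
      using x by auto
    obtain \<C>' where C': "\<C> \<subseteq> \<C>'" "finite \<C>'" "\<forall>c\<in>\<C>'. clopenin ?S c"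
        "subgroups.independent_over (eq_mod N) \<C>'" "eq_mod N \<inter> agree_on \<C>' \<subseteq> eq_mod V"
      using refine_to_open_normal[OF N(1) triv P(1-4)] .
    obtain V' where V': "V' \<in> ?O" "V' \<subseteq> V \<inter> W n" "eq_mod V' \<subseteq> agree_on \<C>'"
      using finite_common_saturation[OF C'(2) bspec[OF C'(3)] open_normal_Int[OF P(4) W(1)]] .
    have "?P (Suc n) (\<C>', V') \<and> ?Q n x (\<C>', V')"
      using C' V' by simp
    then show "\<exists>y. ?P (Suc n) y \<and> ?Q n x y"
      by blast
  qed
  then obtain s where s: "\<forall>n. ?P n (s n) \<and> ?Q n (s n) (s (Suc n))"
    by (rule exE)
  define C where "C n = fst (s n)" for n
  define V where "V n = snd (s n)" for n
  have sCV: "s n = (C n, V n)" for n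
    by (simp add: C_def V_def)
  have C: "finite (C n)" "c \<in> C n \<Longrightarrow> clopenin ?S c" "subgroups.independent_over (eq_mod N) (C n)"
    and V: "V n \<in> ?O" "eq_mod (V n) \<subseteq> agree_on (C n)" "V 0 = U" for n c
    using spec[OF s, of n, THEN conjunct1] spec[OF s, of 0, THEN conjunct1] unfolding sCV by auto
  have CV: "C n \<subseteq> C (Suc n)" "V (Suc n) \<subseteq> V n" "V (Suc n) \<subseteq> W n"
    "eq_mod N \<inter> agree_on (C (Suc n)) \<subseteq> eq_mod (V n)" for n
    using spec[OF s, of n, THEN conjunct2] unfolding sCV by auto
  define N' where "N' = (\<Inter>n. V n)"
  define F' where "F' = F \<union> (\<Union>n. C n)"
  have cut: "countably_cut N'"
    unfolding countably_cut_def N'_def using V(1) by (intro exI[of _ "range V"]) auto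
  have "decseq V"
    using CV(2) by (rule decseq_SucI)
  then have dir: "down_directed (range V)"
    by (rule down_directed_decseq)
  have eqN': "eq_mod N' = (\<Inter>n. eq_mod (V n))"
    unfolding N'_def using V(1) open_normalD(2) open_normal_closed
    by (subst eq_mod_Inter[OF dir]) auto
  have "N' \<subseteq> N"
    using CV(3) by (auto simp: N'_def W(3))
  then have N'N: "eq_mod N' \<subseteq> eq_mod N"
    by (rule eq_mod_mono[OF countably_cutD(2)[OF cut] countably_cutD(2)[OF N(1)]])
  have eq: "eq_mod N' = subgroup_pairs \<inter> agree_on F'"
  proof
    have "eq_mod N' \<subseteq> agree_on (C n)" for n
      using V(2)[of n] unfolding eqN' by blast
    moreover have "eq_mod N' \<subseteq> subgroup_pairs \<inter> agree_on F"
      using N'N N(2) by simp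
    moreover have "agree_on F' = agree_on F \<inter> (\<Inter>n. agree_on (C n))"
      by (auto simp: F'_def agree_on_def)
    ultimately show "eq_mod N' \<subseteq> subgroup_pairs \<inter> agree_on F'"
      by blast
    have "subgroup_pairs \<inter> agree_on F' \<subseteq> eq_mod N \<inter> agree_on (C (Suc n))" for n
      using agree_on_mono[of F F'] agree_on_mono[of "C (Suc n)" F'] unfolding N(2)
      by (auto simp: F'_def)
    then have "subgroup_pairs \<inter> agree_on F' \<subseteq> eq_mod (V n)" for n
      using CV(4)[of n] by (rule order_trans)
    then show "subgroup_pairs \<inter> agree_on F' \<subseteq> eq_mod N'"
      unfolding eqN' by (rule INT_greatest)
  qed
  have clo: "clopenin ?S c" if "c \<in> F \<or> c \<in> C n" for c n
    using that C(2) F by (auto simp: cube_stage_def)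
  have ind: "subgroups.independent (F \<union> C n)" for n
    unfolding subgroups.independent_def topspace_subgroup_space
  proof
    fix \<D>
    obtain H where H: "H \<in> closed_subgroups G T" "\<forall>c\<in>F. H \<in> c \<longleftrightarrow> c \<in> \<D>"
      using F unfolding cube_stage_def subgroups.independent_def topspace_subgroup_space by blast
    then obtain K where K: "(H, K) \<in> eq_mod N" "\<forall>c\<in>C n. K \<in> c \<longleftrightarrow> c \<in> \<D>"
      using C(3)[of n] unfolding subgroups.independent_over_def topspace_subgroup_space by blast
    have "K \<in> closed_subgroups G T"
      using K(1) by (simp add: eq_mod_def)
    moreover have "(H, K) \<in> agree_on F"
      using K(1) N(2) by blast
    then have "\<forall>c\<in>F. K \<in> c \<longleftrightarrow> c \<in> \<D>"
      using H(2) by (simp add: agree_on_def)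
    ultimately show "\<exists>x\<in>closed_subgroups G T. \<forall>c\<in>F \<union> C n. x \<in> c \<longleftrightarrow> c \<in> \<D>"
      using K(2) by (intro bexI[of _ K]) auto
  qed
  have "incseq C"
    using CV(1) by (rule incseq_SucI)
  have "subset.chain UNIV (range (\<lambda>n. F \<union> C n))"
  proof -
    have "F \<union> C i \<subseteq> F \<union> C j \<or> F \<union> C j \<subseteq> F \<union> C i" for i j
      using incseqD[OF \<open>incseq C\<close>, of i j] incseqD[OF \<open>incseq C\<close>, of j i]
      by (cases "i \<le> j") (auto simp: not_le)
    then show ?thesis
      unfolding subset.chain_def by blast
  qed
  then have "subgroups.independent (\<Union>(range (\<lambda>n. F \<union> C n)))"
    by (rule subgroups.independent_Union_chain) (use ind clo in auto)
  then have "subgroups.independent F'"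
    by (simp add: F'_def)
  moreover have "countable F'"
    using F C(1) by (auto simp: F'_def cube_stage_def countable_finite)
  moreover have "\<forall>c\<in>F'. clopenin ?S c"
    using clo by (auto simp: F'_def)
  ultimately have "cube_stage F'"
    using cut eq unfolding cube_stage_def by blast
  moreover have "subgroup_pairs \<inter> agree_on F' \<subseteq> eq_mod U"
    using eq eqN' V(3) by blast
  ultimately show thesis
    using that[of F'] by (simp add: F'_def)
qed

text \<open>Only countably many indices precede a given one, so the stages constructed before it have a
  countable union, and the construction never leaves the metrizable quotients.\<close>

lemma cube_stage_tower:
  assumes triv: "\<not> countably_cut {\<one>}" and u: "\<And>i. u i \<in> open_normal_subgroups G T"
  shows "\<exists>f. (\<forall>i. cube_stage (f i)) \<and> (\<forall>i. subgroup_pairs \<inter> agree_on (f i) \<subseteq> eq_mod (u i)) \<and>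
    (\<forall>i j. (i, j) \<in> aleph1 - Id \<longrightarrow> f i \<subseteq> f j)"
proof -
  let ?R = "aleph1 - Id"
  have wo: "Well_order aleph1" and co: "Card_order aleph1"
    unfolding aleph1_def using cardSuc_Well_order cardSuc_Card_order natLeq_Card_order by auto
  define P where "P f j F \<longleftrightarrow> cube_stage F \<and> subgroup_pairs \<inter> agree_on F \<subseteq> eq_mod (u j) \<and>
    (\<forall>i. (i, j) \<in> ?R \<longrightarrow> f i \<subseteq> F)" for f j F
  have "\<exists>f. \<forall>j. P f j (f j)"
  proof (rule dependent_wf_choice)
    show "wf ?R"
      using wo by (simp add: well_order_on_def)
  next
    fix f g :: "nat set \<Rightarrow> 'a set set set" and j F
    assume "\<And>i. (i, j) \<in> ?R \<Longrightarrow> f i = g i"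
    then show "P f j F = P g j F"
      by (simp add: P_def)
  next
    fix j and f :: "nat set \<Rightarrow> 'a set set set"
    assume f: "\<And>i. (i, j) \<in> ?R \<Longrightarrow> P f i (f i)"
    define I where "I = {i. (i, j) \<in> ?R}"
    have "countable I"
    proof (cases "j \<in> Field aleph1")
      case True
      have "I = underS aleph1 j"
        by (auto simp: I_def underS_def)
      moreover have "|underS aleph1 j| \<le>o natLeq"
        using card_of_underS[OF co True] unfolding aleph1_def
        by (simp add: cardSuc_ordLeq_ordLess natLeq_Card_order)
      ultimately show ?thesis
        by (simp add: countable_card_le_natLeq)
    next
      case False
      then have "I = {}"
        by (auto simp: I_def Field_def)
      then show ?thesis
        by simp
    qed
    let ?\<K> = "insert {} (f ` I)"
    have "f i \<subseteq> f k \<or> f k \<subseteq> f i" if ik: "i \<in> I" "k \<in> I" for i k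
    proof -
      have "i \<in> Field aleph1" "k \<in> Field aleph1"
        using ik by (auto simp: I_def Field_def)
      then have "i = k \<or> (i, k) \<in> ?R \<or> (k, i) \<in> ?R"
        using wo unfolding well_order_on_def linear_order_on_def total_on_def by blast
      then show ?thesis
        using f[of i] f[of k] ik by (auto simp: P_def I_def)
    qed
    then have chain: "subset.chain UNIV ?\<K>"
      unfolding subset.chain_def by auto
    have "cube_stage (\<Union>?\<K>)"
    proof (rule cube_stage_Union[OF chain])
      show "cube_stage F" if "F \<in> ?\<K>" for F
        using that f cube_stage_empty by (auto simp: I_def P_def)
    qed (use \<open>countable I\<close> in auto)
    then obtain F' where "cube_stage F'" "\<Union>?\<K> \<subseteq> F'" "subgroup_pairs \<inter> agree_on F' \<subseteq> eq_mod (u j)"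
      using cube_stage_extend[OF _ triv u[of j]] by metis
    then have "P f j F'"
      by (auto simp: P_def I_def)
    then show "\<exists>F. P f j F" ..
  qed
  then obtain f where "\<forall>j. P f j (f j)"
    by (rule exE)
  then show ?thesis
    unfolding P_def by (intro exI[of _ f]) simp
qed

end

section \<open>The weight of the group\<close>

context profinite_group
begin

text \<open>By compactness a decreasing sequence of open normal subgroups with trivial intersection is a
  base at the identity; its cosets are then a base, and each term has finitely many.\<close>

lemma countably_cut_trivial_imp_countable_base:
  assumes "countably_cut {\<one>}"
  obtains \<B> where "topology_base T \<B>" "countable \<B>"
proof -
  obtain W where W: "\<And>n::nat. W n \<in> open_normal_subgroups G T" "decseq W" "{\<one>} = (\<Inter>n. W n)"
    using countably_cut_sequence[OF assms] by metis
  define \<B> where "\<B> = (\<Union>n. (\<lambda>x. x <# W n) ` carrier G)"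
  have small: "\<exists>n. W n \<subseteq> V" if V: "V \<in> open_normal_subgroups G T" for V
  proof (rule ccontr)
    assume no: "\<nexists>n. W n \<subseteq> V"
    have "\<Inter>(range (\<lambda>n. W n - V)) \<noteq> {}"
    proof (rule compact_directed_Inter_nonempty[OF compact])
      show "down_directed (range (\<lambda>n. W n - V))"
        by (rule down_directed_decseq) (use W(2) in \<open>auto simp: decseq_def\<close>)
      show "closedin T C" if "C \<in> range (\<lambda>n. W n - V)" for C
        using that open_normal_closed[OF W(1)] open_normalD(3)[OF V] by (auto intro: closedin_diff)
      show "{} \<notin> range (\<lambda>n. W n - V)"
        using no by (auto simp: image_iff)
    qed
    then obtain x where x: "\<And>n. x \<in> W n - V"
      by auto
    then have "x \<in> (\<Inter>n. W n)"
      by blast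
    then have "x = \<one>"
      unfolding W(3)[symmetric] by simp
    with x[of 0] open_normalD(5)[OF V] show False
      by simp
  qed
  have "\<exists>B. B \<in> \<B> \<and> x \<in> B \<and> B \<subseteq> U" if U: "openin T U" "x \<in> U" for U x
  proof -
    have xG: "x \<in> carrier G"
      using openin_subset[OF U(1)] U(2) topspace_eq by auto
    let ?U = "{g \<in> topspace T. x \<otimes> g \<in> U}"
    have "continuous_map T T (\<lambda>g. x \<otimes> g)"
      using xG by (intro continuous_map_mult continuous_map_constant) auto
    then have "openin T ?U"
      using U(1) by (rule openin_continuous_map_preimage)
    moreover have "\<one> \<in> ?U"
      using xG U(2) by (simp add: topspace_eq)
    ultimately obtain V where V: "V \<in> open_normal_subgroups G T" "V \<subseteq> ?U"
      by (rule open_normal_subgroup_inside)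
    then obtain n where n: "W n \<subseteq> ?U"
      using small[OF V(1)] by blast
    note W' = open_normalD(2)[OF W(1)[of n]]
    have "x <# W n \<subseteq> U"
      using n by (auto simp: l_coset_def)
    moreover have "x \<in> x <# W n"
      using xG subgroup.one_closed[OF W'] by (simp add: mem_l_coset_iff[OF xG W'])
    ultimately show ?thesis
      using xG by (auto simp: \<B>_def)
  qed
  moreover have "openin T B" if "B \<in> \<B>" for B
    using that clopen_set_mult(1)[OF W(1)] by (auto simp: \<B>_def l_coset_eq_set_mult)
  ultimately have "topology_base T \<B>"
    unfolding topology_base_def openin_topology_base_unique by blast
  moreover have "countable \<B>"
    unfolding \<B>_def by (intro countable_UN countableI_type countable_finite finite_cosets[OF W(1)])
  ultimately show thesis
    by (rule that)
qed

lemma weight_aleph1_imp_not_countably_cut: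
  assumes "weight T =o aleph1"
  shows "\<not> countably_cut {\<one>}"
proof
  assume "countably_cut {\<one>}"
  then obtain \<B> where \<B>: "topology_base T \<B>" "countable \<B>"
    by (rule countably_cut_trivial_imp_countable_base)
  have "weight T \<le>o |\<B>|"
    using weight_is_least[of T] \<B>(1) by metis
  also have "|\<B>| \<le>o natLeq"
    using \<B>(2) by (simp add: countable_card_le_natLeq)
  finally have "aleph1 \<le>o natLeq"
    using assms ordIso_ordLeq_trans ordIso_symmetric by blast
  moreover have "natLeq <o aleph1"
    unfolding aleph1_def by (rule cardSuc_greater[OF natLeq_Card_order])
  ultimately show False
    using not_ordLess_ordLeq by blast
qed

text \<open>One open normal subgroup is chosen inside each basic open set that contains the identity.  There
  are no more of these than basic open sets, and they form a base at the identity.\<close>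

lemma small_neighbourhood_base:
  assumes "weight T =o aleph1"
  obtains u where "\<And>i. u i \<in> open_normal_subgroups G T"
    "\<And>V. V \<in> open_normal_subgroups G T \<Longrightarrow> \<exists>i\<in>Field aleph1. u i \<subseteq> V"
proof -
  obtain \<B> where \<B>: "topology_base T \<B>" "weight T = |\<B>|"
    using weight_is_least[of T] by metis
  have "|Field aleph1| =o |\<B>|"
    using ordIso_transitive[OF card_Field_aleph1 ordIso_symmetric[OF assms]] \<B>(2) by simp
  then obtain g where g: "bij_betw g (Field aleph1) \<B>"
    using card_of_ordIso by blast
  have base: "\<And>B. B \<in> \<B> \<Longrightarrow> openin T B"
      "\<And>U x. openin T U \<Longrightarrow> x \<in> U \<Longrightarrow> \<exists>B. B \<in> \<B> \<and> x \<in> B \<and> B \<subseteq> U"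
    using \<B>(1) unfolding topology_base_def openin_topology_base_unique by blast+
  have "\<forall>i. \<exists>V\<in>open_normal_subgroups G T. i \<in> Field aleph1 \<longrightarrow> \<one> \<in> g i \<longrightarrow> V \<subseteq> g i"
  proof
    fix i
    show "\<exists>V\<in>open_normal_subgroups G T. i \<in> Field aleph1 \<longrightarrow> \<one> \<in> g i \<longrightarrow> V \<subseteq> g i"
    proof (cases "i \<in> Field aleph1 \<and> \<one> \<in> g i")
      case True
      then have "openin T (g i)"
        using base(1) g by (auto simp: bij_betw_def)
      then show ?thesis
        using open_normal_subgroup_inside[of "g i"] True by metis
    next
      case False
      then show ?thesis
        using carrier_open_normal by blast
    qed
  qed
  then obtain u where u: "\<And>i. u i \<in> open_normal_subgroups G T"
      "\<And>i. i \<in> Field aleph1 \<Longrightarrow> \<one> \<in> g i \<Longrightarrow> u i \<subseteq> g i"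
    by metis
  have "\<exists>i\<in>Field aleph1. u i \<subseteq> V" if V: "V \<in> open_normal_subgroups G T" for V
  proof -
    obtain B where B: "B \<in> \<B>" "\<one> \<in> B" "B \<subseteq> V"
      using base(2)[OF open_normalD(3,5)[OF V]] by blast
    then obtain i where "i \<in> Field aleph1" "g i = B"
      using g by (auto simp: bij_betw_def)
    then show ?thesis
      using u(2)[of i] B by blast
  qed
  with u(1) show thesis
    by (rule that)
qed

end

section \<open>The homeomorphism\<close>

context profinite_group
begin

text \<open>Each member of a countable family of clopen sets is saturated modulo some open normal subgroup.
  None of them separates the intersection of these open normal subgroups from the trivial subgroup,
  and by hypothesis this intersection is nontrivial.\<close>

lemma separating_family_uncountable:
  assumes triv: "\<not> countably_cut {\<one>}"
    and clo: "\<And>c. c \<in> F \<Longrightarrow> clopenin (subgroup_space G T) c"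
    and sep: "\<And>H K. \<lbrakk>H \<in> closed_subgroups G T; K \<in> closed_subgroups G T; (H, K) \<in> agree_on F\<rbrakk> \<Longrightarrow> H = K"
  shows "\<not> countable F"
proof
  assume count: "countable F"
  have "\<exists>v\<in>open_normal_subgroups G T. eq_mod v `` c \<subseteq> c" if "c \<in> F" for c
    using clopen_imp_saturated[of c] clo[OF that] unfolding clopenin_def by metis
  then obtain v where v: "\<And>c. c \<in> F \<Longrightarrow> v c \<in> open_normal_subgroups G T"
      "\<And>c. c \<in> F \<Longrightarrow> eq_mod (v c) `` c \<subseteq> c"
    by metis
  define N where "N = \<Inter>(insert (carrier G) (v ` F))"
  have N: "countably_cut N"
    unfolding countably_cut_def N_def using count v(1) carrier_open_normal
    by (intro exI[of _ "insert (carrier G) (v ` F)"]) auto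
  note N' = countably_cutD[OF N]
  have "eq_mod N \<subseteq> agree_on F"
  proof (rule saturated_imp_agree)
    fix c assume c: "c \<in> F"
    have "N \<subseteq> v c"
      using c by (auto simp: N_def)
    then have "eq_mod N \<subseteq> eq_mod (v c)"
      by (rule eq_mod_mono[OF N'(2) open_normalD(2)[OF v(1)[OF c]]])
    then have "eq_mod N `` c \<subseteq> eq_mod (v c) `` c"
      by (rule Image_mono) (rule order_refl)
    also have "\<dots> \<subseteq> c"
      by (rule v(2)[OF c])
    finally show "eq_mod N `` c \<subseteq> c" .
  qed
  moreover have "({\<one>}, N) \<in> eq_mod N"
    using trivial_closed_subgroup N' set_mult_absorb(1)[OF triv_subgroup N'(2)]
      set_mult_absorb(1)[OF N'(2,2) order_refl] subgroup.one_closed[OF N'(2)]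
    by (simp add: eq_mod_def closed_subgroups_def)
  ultimately have "({\<one>}, N) \<in> agree_on F"
    by (rule subsetD)
  moreover have "N \<in> closed_subgroups G T"
    using N' by (simp add: closed_subgroups_def)
  ultimately have "{\<one>} = N"
    using sep trivial_closed_subgroup by blast
  with N triv show False
    by simp
qed

lemma subgroup_space_homeomorphic_cube:
  assumes weight: "weight T =o aleph1"
  shows "subgroup_space G T homeomorphic_space cantor_cube_aleph1"
proof -
  note triv = weight_aleph1_imp_not_countably_cut[OF weight]
  have wo: "Well_order aleph1" and co: "Card_order aleph1"
    unfolding aleph1_def using cardSuc_Well_order cardSuc_Card_order natLeq_Card_order by auto
  have natLeq_aleph1: "natLeq \<le>o aleph1"
    unfolding aleph1_def by (rule cardSuc_ordLeq[OF natLeq_Card_order])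
  have inf: "\<not> finite (Field aleph1)"
    using ordLeq_ordIso_trans[OF natLeq_aleph1 ordIso_symmetric[OF card_Field_aleph1]]
      infinite_iff_natLeq_ordLeq[of "Field aleph1"] by blast
  obtain u where u: "\<And>i. u i \<in> open_normal_subgroups G T"
      "\<And>V. V \<in> open_normal_subgroups G T \<Longrightarrow> \<exists>i\<in>Field aleph1. u i \<subseteq> V"
    using small_neighbourhood_base[OF weight] by metis
  obtain f where "\<forall>i. cube_stage (f i)" "\<forall>i. subgroup_pairs \<inter> agree_on (f i) \<subseteq> eq_mod (u i)"
      "\<forall>i j. (i, j) \<in> aleph1 - Id \<longrightarrow> f i \<subseteq> f j"
    using cube_stage_tower[of u, OF triv u(1)] by (elim exE conjE) rule
  note f = this[rule_format]
  define F where "F = \<Union>(f ` Field aleph1)"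
  have clo: "clopenin (subgroup_space G T) c" if "c \<in> F" for c
    using that f(1) by (auto simp: F_def cube_stage_def)
  have ind: "subgroups.independent F"
    unfolding F_def
  proof (rule subgroups.independent_Union_chain)
    have "f i \<subseteq> f j \<or> f j \<subseteq> f i" if "i \<in> Field aleph1" "j \<in> Field aleph1" for i j
    proof -
      have "i = j \<or> (i, j) \<in> aleph1 - Id \<or> (j, i) \<in> aleph1 - Id"
        using wo that unfolding well_order_on_def linear_order_on_def total_on_def by blast
      then show ?thesis
        using f(3)[of i j] f(3)[of j i] by auto
    qed
    then show "subset.chain UNIV (f ` Field aleph1)"
      unfolding subset.chain_def by auto
    show "f ` Field aleph1 \<noteq> {}"
      using inf by auto
  qed (use f(1) in \<open>auto simp: cube_stage_def\<close>)
  have sep: "H = K" if cs: "H \<in> closed_subgroups G T" "K \<in> closed_subgroups G T"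
    and agree: "(H, K) \<in> agree_on F" for H K
  proof (rule closed_subgroup_eqI[OF cs])
    fix V assume V: "V \<in> open_normal_subgroups G T"
    then obtain i where i: "i \<in> Field aleph1" "u i \<subseteq> V"
      using u(2) by blast
    have "f i \<subseteq> F"
      using i(1) by (auto simp: F_def)
    then have "(H, K) \<in> agree_on (f i)"
      by (rule subsetD[OF agree_on_mono agree])
    then have "(H, K) \<in> eq_mod (u i)"
      using cs by (intro subsetD[OF f(2)]) simp
    then have "(H, K) \<in> eq_mod V"
      by (rule subsetD[OF eq_mod_mono[OF open_normalD(2)[OF u(1)] open_normalD(2)[OF V] i(2)]])
    then show "H <#> V = K <#> V"
      by (simp add: eq_mod_def)
  qed
  have "|F| \<le>o aleph1"
    unfolding F_def
  proof (rule card_of_UNION_ordLeq_infinite_Field[OF inf co])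
    show "|Field aleph1| \<le>o aleph1"
      by (rule ordIso_imp_ordLeq[OF card_Field_aleph1])
    have "|f i| \<le>o natLeq" for i
      using f(1)[of i] by (simp add: cube_stage_def countable_card_le_natLeq)
    then show "\<forall>i\<in>Field aleph1. |f i| \<le>o aleph1"
      using ordLeq_transitive natLeq_aleph1 by blast
  qed
  moreover have "aleph1 \<le>o |F|"
  proof -
    have "\<not> |F| \<le>o natLeq"
      using separating_family_uncountable[OF triv clo sep] by (simp add: countable_card_le_natLeq)
    then have "natLeq <o |F|"
      using not_ordLeq_iff_ordLess[OF natLeq_Well_order card_of_Well_order] by blast
    then show ?thesis
      unfolding aleph1_def by (simp add: cardSuc_ordLess_ordLeq natLeq_Card_order)
  qed
  ultimately have "aleph1 =o |F|"
    by (simp add: ordIso_iff_ordLeq)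
  then have "|Field aleph1| =o |F|"
    by (rule ordIso_transitive[OF card_Field_aleph1])
  then obtain h where h: "bij_betw h (Field aleph1) F"
    using card_of_ordIso by blast
  show ?thesis
    unfolding cantor_cube_aleph1_def
    by (rule subgroups.homeomorphic_cube[OF clo ind _ h])
      (use sep in \<open>simp_all add: topspace_subgroup_space\<close>)
qed

end

theorem theorem6p8:
  fixes G :: "('a, 'b) monoid_scheme" and T :: "'a topology"
  assumes "profinite_group G T"
    and "weight T =o aleph1"
  shows "subgroup_space G T homeomorphic_space cantor_cube_aleph1"
proof -
  interpret profinite_group G T
    by (rule assms(1))
  show ?thesis
    by (rule subgroup_space_homeomorphic_cube[OF assms(2)])
qed

end
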